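(* Let $N\geqslant 4$ and let $\overline{m}=(m_1,\dots,m_s)$ be a sequence of positive integers (multiplicities). Let $I(1^{\times 2^N},\overline{m})$ be the defining ideal of $2^N+s$ generic points in $\mathbb{P}^N$, where $2^N$ of the points have multiplicity $1$ and the remaining $s$ points have multiplicities $m_1,\dots,m_s$ respectively, and let $I(2,\overline{m})$ be the defining ideal of $1+s$ generic points in $\mathbb{P}^N$ with multiplicities $2,m_1,\dots,m_s$. Then $$\widehat{\alpha}\big(I(1^{\times 2^N},\overline{m})\big)\geqslant \widehat{\alpha}\big(I(2,\overline{m})\big).$$ As a consequence, for every positive integer $b$, $$\widehat{\alpha}\big(I(1^{\times b\cdot 2^N},\overline{m})\big)\geqslant \widehat{\alpha}\big(I(2^{\times b},\overline{m})\big).$$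
   Context: $\Bbbk$ is an algebraically closed field. Generic points: for $r$ points, let $\mathbf{z}=(z_{ij})_{1\leqslant i\leqslant r,\,0\leqslant j\leqslant N}$ be independent indeterminates over $\Bbbk$; the $r$ generic points are $P_i(\mathbf{z})=[z_{i0}:\dots:z_{iN}]\in\mathbb{P}^N_{\Bbbk(\mathbf{z})}$, with ideals in $\Bbbk(\mathbf{z})[x_0,\dots,x_N]$. For points $P_1,\dots,P_r$ with homogeneous ideals $\mathfrak{p}_1,\dots,\mathfrak{p}_r$, the ideal of the fat point scheme with multiplicities $a_1,\dots,a_r$ is $I(a_1,\dots,a_r)=\mathfrak{p}_1^{a_1}\cap\dots\cap\mathfrak{p}_r^{a_r}$. The notation $a^{\times t}$ means the entry $a$ repeated $t$ times. The symbolic powers are $I(a_1,\dots,a_r)^{(m)}=I(ma_1,\dots,ma_r)$. For a nonzero homogeneous ideal $J$, $\alpha(J)$ is the least degree of a nonzero element of $J$, and the Waldschmidt constant is $\widehat{\alpha}(J)=\lim_{m\to\infty}\alpha(J^{(m)})/m$. *)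

theory Defs
  imports
    Complex_Main
    "HOL-Library.Poly_Mapping"
    "HOL-Library.Nat_Bijection"
    "HOL-Computational_Algebra.Polynomial"
    "HOL-Computational_Algebra.Fraction_Field"
    "HOL-Algebra.Ideal_Product"
begin

section \<open>Multivariate polynomials\<close>

text \<open>A polynomial in variables indexed by naturals is a finitely supported map from
  exponent vectors to coefficients; the ring structure is the convolution product of
  \<^theory>\<open>HOL-Library.Poly_Mapping\<close>.\<close>

type_synonym 'a mpoly = "(nat \<Rightarrow>\<^sub>0 nat) \<Rightarrow>\<^sub>0 'a"

definition mono_deg :: "(nat \<Rightarrow>\<^sub>0 nat) \<Rightarrow> nat" where
  "mono_deg t = (\<Sum>i\<in>Poly_Mapping.keys t. Poly_Mapping.lookup t i)"

definition indets :: "'a::zero mpoly \<Rightarrow> nat set" where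
  "indets p = (\<Union>t\<in>Poly_Mapping.keys p. Poly_Mapping.keys t)"

definition eval_mpoly :: "(nat \<Rightarrow> 'a::comm_semiring_1) \<Rightarrow> 'a mpoly \<Rightarrow> 'a" where
  "eval_mpoly v p =
     (\<Sum>t\<in>Poly_Mapping.keys p.
        Poly_Mapping.lookup p t * (\<Prod>i\<in>Poly_Mapping.keys t. v i ^ Poly_Mapping.lookup t i))"

definition homogeneous :: "'a::zero mpoly \<Rightarrow> bool" where
  "homogeneous p \<longleftrightarrow> (\<exists>d. \<forall>t\<in>Poly_Mapping.keys p. mono_deg t = d)"

text \<open>Only meaningful for nonzero \<open>p\<close>.\<close>
definition total_deg :: "'a::zero mpoly \<Rightarrow> nat" where
  "total_deg p = Max (mono_deg ` Poly_Mapping.keys p)"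

text \<open>Only meaningful if \<open>J\<close> has a nonzero element.\<close>
definition initial_degree :: "'a::zero mpoly set \<Rightarrow> nat" where
  "initial_degree J = (LEAST d. \<exists>p\<in>J. p \<noteq> 0 \<and> total_deg p = d)"


section \<open>The field of rational functions in the coordinates of the generic points\<close>

text \<open>All fields \<open>k(z)\<close> live inside one field of fractions, over \<open>k\<close>, in countably many
  indeterminates. The indeterminate \<open>z\<^sub>i\<^sub>j\<close> is the variable number
  \<open>prod_encode (i, j)\<close>, and \<open>ratfuns r N\<close> is the subfield \<open>k(z)\<close> for
  \<open>z = (z\<^sub>i\<^sub>j)\<close> with \<open>i < r\<close> and \<open>j \<le> N\<close>; the points are numbered from \<open>0\<close>.\<close>

type_synonym 'k ratfun = "'k mpoly fract"

definition zvars :: "nat \<Rightarrow> nat \<Rightarrow> nat set" where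
  "zvars r N = prod_encode ` ({..<r} \<times> {..N})"

definition ratfuns :: "nat \<Rightarrow> nat \<Rightarrow> 'k::field ratfun set" where
  "ratfuns r N = {Fract p q | p q. q \<noteq> 0 \<and> indets p \<subseteq> zvars r N \<and> indets q \<subseteq> zvars r N}"

text \<open>Homogeneous coordinates of the generic point \<open>P\<^sub>i(z)\<close>.\<close>
definition generic_point :: "nat \<Rightarrow> nat \<Rightarrow> 'k::field ratfun" where
  "generic_point i j =
     Fract (Poly_Mapping.single (Poly_Mapping.single (prod_encode (i, j)) 1) 1) 1"


section \<open>Fat point ideals and Waldschmidt constants\<close>

text \<open>The ring \<open>k(z)[x\<^sub>0, \<dots>, x\<^sub>N]\<close> for \<open>r\<close> generic points.\<close>
definition coord_ring :: "nat \<Rightarrow> nat \<Rightarrow> 'k::field ratfun mpoly ring" where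
  "coord_ring r N =
     \<lparr>carrier = {f. indets f \<subseteq> {..N} \<and> (\<forall>t. Poly_Mapping.lookup f t \<in> ratfuns r N)},
      mult = (*), one = 1, zero = 0, add = (+)\<rparr>"

definition point_ideal :: "nat \<Rightarrow> nat \<Rightarrow> (nat \<Rightarrow> 'k::field ratfun) \<Rightarrow> 'k ratfun mpoly set" where
  "point_ideal r N v =
     Idl\<^bsub>coord_ring r N\<^esub>
       {f \<in> carrier (coord_ring r N). homogeneous f \<and> eval_mpoly v f = 0}"

text \<open>\<open>I(a\<^sub>0, \<dots>, a\<^sub>r\<^sub>-\<^sub>1)\<close> for \<open>r = length a\<close> generic points. Powers of ideals are taken in the
  multiplicative monoid of ideals. The intersection with the ring only matters for \<open>r = 0\<close>.\<close>
definition fat_ideal :: "nat \<Rightarrow> nat list \<Rightarrow> 'k::field ratfun mpoly set" where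
  "fat_ideal N a =
     (let R = coord_ring (length a) N in
      carrier R \<inter>
      (\<Inter>i<length a. point_ideal (length a) N (generic_point i) [^]\<^bsub>ideals_set R\<^esub> (a ! i)))"

definition symbolic_power :: "nat \<Rightarrow> nat list \<Rightarrow> nat \<Rightarrow> 'k::field ratfun mpoly set" where
  "symbolic_power N a m = fat_ideal N (map (\<lambda>c. m * c) a)"

text \<open>The Waldschmidt constant of \<open>I(a)\<close> in projective \<open>N\<close>-space; the first argument records the ground field.\<close>
definition waldschmidt :: "'k::field itself \<Rightarrow> nat \<Rightarrow> nat list \<Rightarrow> real" where
  "waldschmidt _ N a =
     lim (\<lambda>m. real (initial_degree (symbolic_power N a m :: 'k ratfun mpoly set)) / real m)"


section \<open>The coordinate ring is a commutative ring, and fat point ideals are ideals\<close>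

lemma indets_zero [simp]: "indets 0 = {}"
  and indets_one [simp]: "indets (1 :: 'a::zero_neq_one mpoly) = {}"
  by (simp_all add: indets_def)

lemma indets_add: "indets (p + q :: 'a::comm_monoid_add mpoly) \<subseteq> indets p \<union> indets q"
  unfolding indets_def using Poly_Mapping.keys_add[of p q] by blast

lemma indets_uminus [simp]: "indets (- p :: 'a::ab_group_add mpoly) = indets p"
  by (simp add: indets_def keys.rep_eq)

lemma indets_mult: "indets (p * q :: 'a::semiring_0 mpoly) \<subseteq> indets p \<union> indets q"
proof
  fix x assume "x \<in> indets (p * q)"
  then obtain t where t: "t \<in> Poly_Mapping.keys (p * q)" "x \<in> Poly_Mapping.keys t"
    by (auto simp: indets_def)
  then obtain u w where "u \<in> Poly_Mapping.keys p" "w \<in> Poly_Mapping.keys q" "t = u + w"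
    using keys_mult[of p q] by blast
  with t(2) show "x \<in> indets p \<union> indets q"
    using Poly_Mapping.keys_add[of u w] by (auto simp: indets_def)
qed

lemma ratfunsI:
  "q \<noteq> 0 \<Longrightarrow> indets p \<subseteq> zvars r N \<Longrightarrow> indets q \<subseteq> zvars r N \<Longrightarrow> Fract p q \<in> ratfuns r N"
  by (auto simp: ratfuns_def)

lemma ratfunsE:
  assumes "a \<in> ratfuns r N"
  obtains p q where "a = Fract p q" "q \<noteq> 0" "indets p \<subseteq> zvars r N" "indets q \<subseteq> zvars r N"
  using assms by (auto simp: ratfuns_def)

lemma ratfuns_0 [simp]: "0 \<in> ratfuns r N"
  and ratfuns_1 [simp]: "1 \<in> ratfuns r N"
  unfolding Zero_fract_def One_fract_def by (auto intro!: ratfunsI)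

lemma ratfuns_add [intro]:
  assumes "a \<in> ratfuns r N" "b \<in> ratfuns r N" shows "a + b \<in> ratfuns r N"
proof -
  obtain p q where a: "a = Fract p q" "q \<noteq> 0" "indets p \<subseteq> zvars r N" "indets q \<subseteq> zvars r N"
    using assms(1) by (rule ratfunsE)
  obtain p' q' where b: "b = Fract p' q'" "q' \<noteq> 0" "indets p' \<subseteq> zvars r N" "indets q' \<subseteq> zvars r N"
    using assms(2) by (rule ratfunsE)
  have "indets (p * q' + p' * q) \<subseteq> zvars r N" "indets (q * q') \<subseteq> zvars r N"
    using a b indets_add[of "p * q'" "p' * q"] indets_mult[of p q'] indets_mult[of p' q]
      indets_mult[of q q'] by blast+
  then show ?thesis using a b by (auto intro!: ratfunsI)
qed

lemma ratfuns_mult [intro]: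
  assumes "a \<in> ratfuns r N" "b \<in> ratfuns r N" shows "a * b \<in> ratfuns r N"
proof -
  obtain p q where a: "a = Fract p q" "q \<noteq> 0" "indets p \<subseteq> zvars r N" "indets q \<subseteq> zvars r N"
    using assms(1) by (rule ratfunsE)
  obtain p' q' where b: "b = Fract p' q'" "q' \<noteq> 0" "indets p' \<subseteq> zvars r N" "indets q' \<subseteq> zvars r N"
    using assms(2) by (rule ratfunsE)
  have "indets (p * p') \<subseteq> zvars r N" "indets (q * q') \<subseteq> zvars r N"
    using a b indets_mult[of p p'] indets_mult[of q q'] by blast+
  then show ?thesis using a b by (auto intro!: ratfunsI)
qed

lemma ratfuns_uminus [intro]: "a \<in> ratfuns r N \<Longrightarrow> - a \<in> ratfuns r N"
  by (erule ratfunsE) (auto intro!: ratfunsI)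

lemma ratfuns_inverse [intro]: "a \<in> ratfuns r N \<Longrightarrow> inverse a \<in> ratfuns r N"
proof (erule ratfunsE)
  fix p q assume *: "a = Fract p q" "q \<noteq> 0" "indets p \<subseteq> zvars r N" "indets q \<subseteq> zvars r N"
  show "inverse a \<in> ratfuns r N"
    using * by (cases "p = 0") (auto intro!: ratfunsI simp: fract_collapse)
qed

lemma generic_point_in_ratfuns: "i < r \<Longrightarrow> j \<le> N \<Longrightarrow> generic_point i j \<in> ratfuns r N"
  unfolding generic_point_def by (rule ratfunsI) (auto simp: indets_def zvars_def)

lemma ratfuns_sum [intro]: "(\<And>x. x \<in> A \<Longrightarrow> f x \<in> ratfuns r N) \<Longrightarrow> sum f A \<in> ratfuns r N"
  by (induction A rule: infinite_finite_induct) auto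

lemma ratfuns_lookup_mult:
  fixes f g :: "'k::field ratfun mpoly"
  assumes "\<And>t. Poly_Mapping.lookup f t \<in> ratfuns r N" "\<And>t. Poly_Mapping.lookup g t \<in> ratfuns r N"
  shows "Poly_Mapping.lookup (f * g) t \<in> ratfuns r N"
proof -
  have 1: "Sum_any h \<in> ratfuns r N" if "\<And>x. h x \<in> ratfuns r N"
    for h :: "(nat \<Rightarrow>\<^sub>0 nat) \<Rightarrow> 'k ratfun"
    using that by (auto simp: Sum_any.expand_set)
  have 2: "(a when P) \<in> ratfuns r N" if "a \<in> ratfuns r N" for a :: "'k ratfun" and P
    using that by (auto simp: when_def)
  show ?thesis
    unfolding lookup_mult by (intro 1 2 ratfuns_mult assms)
qed

lemma cring_coord_ring: "cring (coord_ring r N :: 'k::field ratfun mpoly ring)"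
proof (rule cringI)
  let ?R = "coord_ring r N :: 'k ratfun mpoly ring"
  show "abelian_group ?R"
  proof (rule abelian_groupI)
    fix x y assume "x \<in> carrier ?R" "y \<in> carrier ?R"
    then show "x \<oplus>\<^bsub>?R\<^esub> y \<in> carrier ?R"
      using indets_add[of x y] by (auto simp: coord_ring_def lookup_add)
  next
    fix x assume "x \<in> carrier ?R"
    then show "\<exists>y\<in>carrier ?R. y \<oplus>\<^bsub>?R\<^esub> x = \<zero>\<^bsub>?R\<^esub>"
      by (intro bexI[of _ "- x"]) (auto simp: coord_ring_def)
  qed (auto simp: coord_ring_def algebra_simps)
  show "Group.comm_monoid ?R"
  proof (rule comm_monoidI)
    fix x y assume "x \<in> carrier ?R" "y \<in> carrier ?R"
    then show "x \<otimes>\<^bsub>?R\<^esub> y \<in> carrier ?R"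
      using indets_mult[of x y] by (auto simp: coord_ring_def intro!: ratfuns_lookup_mult)
  qed (auto simp: coord_ring_def algebra_simps lookup_one when_def)
qed (auto simp: coord_ring_def algebra_simps)

lemma ideal_fat_ideal:
  "ideal (fat_ideal N a :: 'k::field ratfun mpoly set) (coord_ring (length a) N)"
proof -
  let ?R = "coord_ring (length a) N :: 'k ratfun mpoly ring"
  interpret R: cring ?R by (rule cring_coord_ring)
  interpret M: Group.comm_monoid "ideals_set ?R" by (rule R.ideals_set_is_comm_monoid)
  let ?J = "\<lambda>i. point_ideal (length a) N (generic_point i) [^]\<^bsub>ideals_set ?R\<^esub> (a ! i)"
  have J: "ideal (?J i) ?R" for i
  proof -
    have "ideal (point_ideal (length a) N (generic_point i :: nat \<Rightarrow> 'k ratfun)) ?R"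
      unfolding point_ideal_def by (rule R.genideal_ideal) auto
    then have "?J i \<in> carrier (ideals_set ?R)"
      by (intro M.nat_pow_closed) (simp add: ideals_set_def)
    then show ?thesis by (simp add: ideals_set_def)
  qed
  show ?thesis
  proof (cases "length a = 0")
    case True
    then show ?thesis using R.oneideal by (simp add: fat_ideal_def Let_def)
  next
    case False
    then have "ideal (\<Inter>(?J ` {..<length a})) ?R"
      using J by (intro R.i_Intersect) auto
    then have "ideal (carrier ?R \<inter> \<Inter>(?J ` {..<length a})) ?R"
      using R.i_intersect R.oneideal by blast
    then show ?thesis by (simp add: fat_ideal_def Let_def)
  qed
qed

end

theory Submission
  imports Defs
begin

text \<open>Suppose a form of degree \<open>d\<close> vanishes to order \<open>m\<close> at \<open>2\<^sup>N\<close> generic points. Let these points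
  collide: specialize them to \<open>V + T Q\<close> with \<open>Q \<in> {0, 1}\<^sup>N\<close>, where \<open>V\<close> is one further generic
  point, divide the form by the largest possible power of \<open>T\<close>, and put \<open>T = 0\<close>. If the resulting
  form vanishes to order \<open>e\<close> at \<open>V\<close>, then rescaling by \<open>T\<close> around \<open>V\<close> before putting \<open>T = 0\<close>
  gives a nonzero polynomial of degree at most \<open>e\<close> that vanishes to order \<open>m\<close> on the grid
  \<open>{0, 1}\<^sup>N\<close>, and such a polynomial has degree at least \<open>2 m\<close>; so \<open>e \<ge> 2 m\<close>. Hence the initial
  degrees of the symbolic powers satisfy the inequality for every \<open>m\<close>, and Fekete's lemma gives the
  existence of both limits. Colliding one block of \<open>2\<^sup>N\<close> points at a time gives the second
  statement.\<close>

section \<open>Substitution homomorphisms and vanishing orders\<close>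

text \<open>The form has coefficients in k(z), and these cannot simply be specialized, because
  denominators may vanish at the colliding points. Vanishing to prescribed orders is, however, a
  homogeneous linear system in the coefficients of the form, with matrix entries in k[z]. A nonzero
  solution over k(z) forces one over every domain that receives k[z], since minors that vanish keep
  vanishing under a homomorphism. \<open>linear_system_transfer\<close> realizes this by
  fraction-free elimination and is used twice: to pass from the generic points to k[z][T] with the
  colliding points, and, after T = 0, to return to the field \<open>ratfuns\<close> of the smaller
  set of points, since the limit form may involve other indeterminates. The number 2^N is the size
  of {0, 1}^N; the factor 2 counts the hyperplanes x = 0 and x = 1 that cover the grid in one
  direction. The fat point ideals are built from powers of ideals. For forms, lying in the n-th
  power of a point ideal has to be identified with vanishing to order n; this works because the
  ideal contains linear forms that serve as coordinates at the point.\<close>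

abbreviation lookup where "lookup \<equiv> Poly_Mapping.lookup"
abbreviation keys where "keys \<equiv> Poly_Mapping.keys"
abbreviation single where "single \<equiv> Poly_Mapping.single"

definition rhom :: "('a::comm_ring_1 \<Rightarrow> 'b::comm_ring_1) \<Rightarrow> bool" where
  "rhom h \<longleftrightarrow> h 1 = 1 \<and> (\<forall>x y. h (x + y) = h x + h y) \<and> (\<forall>x y. h (x * y) = h x * h y)"

lemma rhomI:
  "h 1 = 1 \<Longrightarrow> (\<And>x y. h (x + y) = h x + h y) \<Longrightarrow> (\<And>x y. h (x * y) = h x * h y) \<Longrightarrow> rhom h"
  by (simp add: rhom_def)

context
  fixes h :: "'a::comm_ring_1 \<Rightarrow> 'b::comm_ring_1"
  assumes h: "rhom h"
begin

lemma rhom_1: "h 1 = 1" and rhom_add: "h (x + y) = h x + h y" and rhom_mult: "h (x * y) = h x * h y"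
  using h by (auto simp: rhom_def)

lemma rhom_0: "h 0 = 0"
  using rhom_add[of 0 0] by simp

lemma rhom_minus: "h (- x) = - h x"
  using rhom_add[of x "- x"] rhom_0 by (simp add: eq_neg_iff_add_eq_0 add.commute)

lemma rhom_diff: "h (x - y) = h x - h y"
  using rhom_add[of x "- y"] rhom_minus by simp

lemma rhom_sum: "h (sum f A) = (\<Sum>x\<in>A. h (f x))"
  by (induction A rule: infinite_finite_induct) (auto simp: rhom_0 rhom_add)

lemma rhom_prod: "h (prod f A) = (\<Prod>x\<in>A. h (f x))"
  by (induction A rule: infinite_finite_induct) (auto simp: rhom_1 rhom_mult)

lemma rhom_power: "h (x ^ n) = h x ^ n"
  by (induction n) (auto simp: rhom_1 rhom_mult)

end

lemma rhom_id: "rhom id" "rhom (\<lambda>x. x)"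
  by (auto simp: rhom_def)

lemma rhom_comp: "rhom f \<Longrightarrow> rhom g \<Longrightarrow> rhom (f \<circ> g)"
  by (auto simp: rhom_def)

section \<open>Monomials, weighted degrees and the universal property of polynomial rings\<close>

definition monev :: "(nat \<Rightarrow> 'b::comm_monoid_mult) \<Rightarrow> (nat \<Rightarrow>\<^sub>0 nat) \<Rightarrow> 'b" where
  "monev v t = (\<Prod>i\<in>keys t. v i ^ lookup t i)"

lemma monev_superset:
  assumes "finite A" "keys t \<subseteq> A"
  shows "monev v t = (\<Prod>i\<in>A. v i ^ lookup t i)"
  unfolding monev_def using assms by (intro prod.mono_neutral_left) (auto simp: in_keys_iff)

lemma monev_0 [simp]: "monev v 0 = 1"
  by (simp add: monev_def)

lemma monev_add: "monev v (s + t) = monev v s * monev v t"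
proof -
  let ?A = "keys s \<union> keys t"
  have "keys (s + t) \<subseteq> ?A" by (rule Poly_Mapping.keys_add)
  then show ?thesis
    by (simp add: monev_superset[of ?A] lookup_add power_add prod.distrib)
qed

lemma monev_single [simp]: "monev v (single i n) = v i ^ n"
  by (cases "n = 0") (auto simp: monev_def)

lemma monev_cong: "(\<And>i. i \<in> keys t \<Longrightarrow> v i = w i) \<Longrightarrow> monev v t = monev w t"
  by (auto simp: monev_def intro: prod.cong)

lemma monev_rhom: "rhom h \<Longrightarrow> h (monev v t) = monev (h \<circ> v) t"
  by (simp add: monev_def rhom_prod rhom_power)

definition wdeg :: "(nat \<Rightarrow> nat) \<Rightarrow> (nat \<Rightarrow>\<^sub>0 nat) \<Rightarrow> nat" where
  "wdeg w t = (\<Sum>i\<in>keys t. w i * lookup t i)"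

lemma wdeg_superset:
  assumes "finite A" "keys t \<subseteq> A"
  shows "wdeg w t = (\<Sum>i\<in>A. w i * lookup t i)"
  unfolding wdeg_def using assms by (intro sum.mono_neutral_left) (auto simp: in_keys_iff)

lemma wdeg_0 [simp]: "wdeg w 0 = 0"
  by (simp add: wdeg_def)

lemma wdeg_add: "wdeg w (s + t) = wdeg w s + wdeg w t"
proof -
  let ?A = "keys s \<union> keys t"
  have "keys (s + t) \<subseteq> ?A" by (rule Poly_Mapping.keys_add)
  then show ?thesis
    by (simp add: wdeg_superset[of ?A] lookup_add distrib_left sum.distrib)
qed

lemma wdeg_single [simp]: "wdeg w (single i n) = w i * n"
  by (cases "n = 0") (auto simp: wdeg_def)

lemma mono_deg_eq_wdeg: "mono_deg t = wdeg (\<lambda>_. 1) t"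
  by (simp add: mono_deg_def wdeg_def)

lemma monev_power: "monev (\<lambda>i. c ^ w i) t = c ^ wdeg w t"
  by (simp add: monev_def wdeg_def power_mult power_sum)

lemma monev_mult: "monev (\<lambda>i. v i * w i) t = monev v t * monev w t"
  by (simp add: monev_def power_mult_distrib prod.distrib)

definition Cst :: "'a::zero \<Rightarrow> 'a mpoly" where "Cst c = single 0 c"
definition X :: "nat \<Rightarrow> 'a::zero_neq_one mpoly" where "X i = single (single i 1) 1"

lemma lookup_single_mult:
  fixes p :: "'a::comm_ring_1 mpoly"
  shows "lookup (single s c * p) (s + t) = c * lookup p t"
proof -
  have "lookup (single s c * p) (s + t) =
      (\<Sum>l. lookup (single s c) l * (\<Sum>q. lookup p q when s + t = l + q))"
    by (rule lookup_mult)
  also have "\<dots> = (\<Sum>l. (c * (\<Sum>q. lookup p q when s + t = l + q)) when s = l)"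
    by (rule arg_cong[where f = Sum_any]) (auto simp: lookup_single when_def)
  also have "\<dots> = c * lookup p t" by simp
  finally show ?thesis .
qed

lemma lookup_Cst_mult [simp]: "lookup (Cst c * p) t = c * lookup (p :: 'a::comm_ring_1 mpoly) t"
  using lookup_single_mult[of 0 c p t] by (simp add: Cst_def)

lemma rhom_Cst: "rhom (Cst :: 'a::comm_ring_1 \<Rightarrow> _)"
  by (rule rhomI) (auto simp: Cst_def single_add mult_single)

lemma monev_X: "monev X t = (single t 1 :: 'a::comm_ring_1 mpoly)"
proof -
  have *: "X i ^ n = (single (single i n) 1 :: 'a mpoly)" for i n
    by (induction n) (auto simp: X_def mult_single single_add[symmetric])
  have **: "finite A \<Longrightarrow> (\<Prod>i\<in>A. single (single i (lookup t i)) 1) =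
      (single (\<Sum>i\<in>A. single i (lookup t i)) 1 :: 'a mpoly)" for A
    by (induction A rule: finite_induct) (auto simp: mult_single)
  have "(\<Sum>i\<in>keys t. single i (lookup t i)) = t"
    by (rule poly_mapping_eqI) (auto simp: lookup_sum lookup_single when_def sum.delta in_keys_iff)
  then show ?thesis by (simp add: monev_def * **)
qed

lemma single_eq: "single t c = Cst c * monev X t" for c :: "'a::comm_ring_1"
  by (simp add: monev_X Cst_def mult_single)

lemma mpoly_sum_single: "(\<Sum>t\<in>keys p. single t (lookup p t)) = p"
  for p :: "'a::comm_ring_1 mpoly"
  by (rule poly_mapping_eqI) (auto simp: lookup_sum lookup_single when_def sum.delta in_keys_iff)

lemma mpoly_induct [case_names single add]:
  fixes p :: "'a::comm_ring_1 mpoly"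
  assumes "\<And>t c. P (single t c)" and "\<And>p q. P p \<Longrightarrow> P q \<Longrightarrow> P (p + q)"
  shows "P p"
proof -
  have "P (\<Sum>t\<in>A. single t (lookup p t))" if "finite A" for A
    using that
  proof (induction A)
    case empty
    show ?case using assms(1)[of 0 0] by simp
  qed (use assms in auto)
  from this[of "keys p"] show ?thesis by (simp add: mpoly_sum_single)
qed

text \<open>For a homomorphism \<open>h\<close>, this is the homomorphism that extends
  \<open>h\<close> and sends \<open>X i\<close> to \<open>v i\<close>. Evaluation, change of
  coefficients, translation, scaling, restriction to hyperplanes and passage to univariate
  polynomials are all instances of it.\<close>

definition subst :: "('a::comm_ring_1 \<Rightarrow> 'b::comm_ring_1) \<Rightarrow> (nat \<Rightarrow> 'b) \<Rightarrow> 'a mpoly \<Rightarrow> 'b" where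
  "subst h v p = (\<Sum>t\<in>keys p. h (lookup p t) * monev v t)"

lemma subst_superset:
  assumes "rhom h" "finite A" "keys p \<subseteq> A"
  shows "subst h v p = (\<Sum>t\<in>A. h (lookup p t) * monev v t)"
  unfolding subst_def using assms by (intro sum.mono_neutral_left) (auto simp: in_keys_iff rhom_0)

lemma subst_add:
  assumes "rhom h" shows "subst h v (p + q) = subst h v p + subst h v q"
proof -
  let ?A = "keys p \<union> keys q"
  have "keys (p + q) \<subseteq> ?A" by (rule Poly_Mapping.keys_add)
  then show ?thesis
    by (simp add: subst_superset[OF assms, of ?A] lookup_add rhom_add[OF assms] distrib_right sum.distrib)
qed

lemma subst_single:
  assumes "rhom h" shows "subst h v (single t c) = h c * monev v t"
  by (cases "c = 0") (auto simp: subst_def rhom_0[OF assms])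

lemma rhom_subst:
  fixes h :: "'a::comm_ring_1 \<Rightarrow> 'b::comm_ring_1"
  assumes "rhom h" shows "rhom (subst h v)"
proof (rule rhomI)
  show "subst h v 1 = 1"
    using subst_single[OF assms, of v 0 1] by (simp add: rhom_1[OF assms])
  show "subst h v (p + q) = subst h v p + subst h v q" for p q
    by (rule subst_add[OF assms])
  have 1: "subst h v (single s c * q) = subst h v (single s c) * subst h v q" for s c q
  proof (induction q rule: mpoly_induct)
    case (single t d)
    then show ?case
      by (simp add: mult_single subst_single[OF assms] rhom_mult[OF assms] monev_add mult_ac)
  next
    case (add p q)
    then show ?case by (simp add: distrib_left subst_add[OF assms])
  qed
  show "subst h v (p * q) = subst h v p * subst h v q" for p q
    by (induction p rule: mpoly_induct) (simp_all add: 1 distrib_right subst_add[OF assms])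
qed

lemma subst_Cst: "rhom h \<Longrightarrow> subst h v (Cst c) = h c"
  by (simp add: Cst_def subst_single)

lemma subst_X: "rhom h \<Longrightarrow> subst h v (X i) = v i"
  by (simp add: X_def subst_single rhom_1)

text \<open>Uniqueness in the universal property. Every later identity between composed
  substitutions is checked only on constants and variables through this rule.\<close>

lemma rhom_mpoly_eqI:
  fixes f g :: "'a::comm_ring_1 mpoly \<Rightarrow> 'b::comm_ring_1"
  assumes "rhom f" "rhom g" "\<And>c. f (Cst c) = g (Cst c)" "\<And>i. f (X i) = g (X i)"
  shows "f p = g p"
proof (induction p rule: mpoly_induct)
  case (single t c)
  have "f \<circ> X = g \<circ> X" using assms(4) by auto
  then show ?case
    by (simp add: single_eq rhom_mult[OF assms(1)] rhom_mult[OF assms(2)] monev_rhom[OF assms(1)]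
        monev_rhom[OF assms(2)] assms(3))
next
  case (add p q)
  then show ?case by (simp add: rhom_add[OF assms(1)] rhom_add[OF assms(2)])
qed

lemma subst_cong:
  assumes "\<And>i. i \<in> indets p \<Longrightarrow> v i = w i" shows "subst h v p = subst h w p"
  unfolding subst_def
proof (rule sum.cong)
  fix t assume "t \<in> keys p"
  then have "monev v t = monev w t" using assms by (intro monev_cong) (auto simp: indets_def)
  then show "h (lookup p t) * monev v t = h (lookup p t) * monev w t" by simp
qed simp

lemma eval_mpoly_eq_subst: "eval_mpoly v p = subst (\<lambda>c. c) v p"
  by (simp add: eval_mpoly_def subst_def monev_def)

lemma subst_Cst_X: "subst Cst X p = p"
  by (rule rhom_mpoly_eqI[where f = "subst Cst X" and g = "\<lambda>p. p"]) (auto simp: rhom_subst rhom_Cst rhom_id subst_Cst subst_X)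

definition cmap :: "('a::comm_ring_1 \<Rightarrow> 'b::comm_ring_1) \<Rightarrow> 'a mpoly \<Rightarrow> 'b mpoly" where
  "cmap h = subst (Cst \<circ> h) X"

lemma rhom_cmap: "rhom h \<Longrightarrow> rhom (cmap h)"
  unfolding cmap_def by (intro rhom_subst rhom_comp rhom_Cst)

lemma cmap_Cst: "rhom h \<Longrightarrow> cmap h (Cst c) = Cst (h c)"
  unfolding cmap_def by (simp add: subst_Cst rhom_comp rhom_Cst)

lemma cmap_X: "rhom h \<Longrightarrow> cmap h (X i) = X i"
  unfolding cmap_def by (simp add: subst_X rhom_comp rhom_Cst)

lemma lookup_cmap: "rhom h \<Longrightarrow> lookup (cmap h p) t = h (lookup p t)"
proof (induction p rule: mpoly_induct)
  case (single s c)
  then show ?case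
    by (simp add: cmap_def subst_single rhom_comp rhom_Cst monev_X Cst_def mult_single lookup_single
        when_def rhom_0)
next
  case (add p q)
  then show ?case by (simp add: rhom_add[OF rhom_cmap] rhom_add lookup_add)
qed

text \<open>In affine coordinates around \<open>v\<close> (taking \<open>x\<^sub>0\<close> as the homogenizing variable), \<open>recenter v f\<close> is \<open>f\<close>
  moved so that \<open>v\<close> becomes the origin; no division by \<open>v 0\<close> is needed.\<close>
definition recenter_vars :: "(nat \<Rightarrow> 'a::comm_ring_1) \<Rightarrow> nat \<Rightarrow> 'a mpoly" where
  "recenter_vars v i = (if i = 0 then Cst (v 0) * X 0 else X i + Cst (v i) * X 0)"

definition recenter :: "(nat \<Rightarrow> 'a::comm_ring_1) \<Rightarrow> 'a mpoly \<Rightarrow> 'a mpoly" where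
  "recenter v = subst Cst (recenter_vars v)"

definition grid_weight :: "nat set \<Rightarrow> nat \<Rightarrow> nat" where
  "grid_weight S i = of_bool (i \<in> S)"

text \<open>The homogenizing variable 0 has weight 0, so only affine coordinates count. For
  \<open>v 0\<close> nonzero, \<open>yord_ge N a (recenter v f)\<close> therefore expresses
  vanishing of \<open>f\<close> to order \<open>a\<close> at the point \<open>v\<close>.\<close>

definition ydeg :: "nat \<Rightarrow> (nat \<Rightarrow>\<^sub>0 nat) \<Rightarrow> nat" where
  "ydeg N = wdeg (grid_weight {1..N})"

definition yord_ge :: "nat \<Rightarrow> nat \<Rightarrow> 'a::zero mpoly \<Rightarrow> bool" where
  "yord_ge N a p \<longleftrightarrow> (\<forall>t\<in>keys p. a \<le> ydeg N t)"

lemma yord_ge_iff: "yord_ge N a p \<longleftrightarrow> (\<forall>t. ydeg N t < a \<longrightarrow> lookup p t = 0)"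
  by (auto simp: yord_ge_def in_keys_iff not_le[symmetric])

lemma ydeg_add: "ydeg N (s + t) = ydeg N s + ydeg N t"
  by (simp add: ydeg_def wdeg_add)

lemma yord_ge_add: "yord_ge N a p \<Longrightarrow> yord_ge N a q \<Longrightarrow> yord_ge N a (p + q)"
  by (simp add: yord_ge_iff lookup_add)

lemma yord_ge_mult:
  fixes p q :: "'a::comm_ring_1 mpoly"
  shows "yord_ge N a p \<Longrightarrow> yord_ge N b q \<Longrightarrow> yord_ge N (a + b) (p * q)"
  using keys_mult[of p q] by (fastforce simp: yord_ge_def ydeg_add add_mono)

lemma yord_ge_0: "yord_ge N 0 p"
  by (simp add: yord_ge_def)

lemma rhom_recenter: "rhom (recenter v)"
  unfolding recenter_def by (intro rhom_subst rhom_Cst)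

lemma recenter_Cst [simp]: "recenter v (Cst c) = Cst c"
  by (simp add: recenter_def subst_Cst rhom_Cst)

lemma recenter_X: "recenter v (X i) = (if i = 0 then Cst (v 0) * X 0 else X i + Cst (v i) * X 0)"
  by (simp add: recenter_def subst_X rhom_Cst recenter_vars_def)

lemma cmap_recenter:
  assumes h: "rhom h" shows "cmap h (recenter v p) = recenter (h \<circ> v) (cmap h p)"
proof -
  have "(cmap h \<circ> recenter v) p = (recenter (h \<circ> v) \<circ> cmap h) p"
    by (rule rhom_mpoly_eqI[where f = "cmap h \<circ> recenter v" and g = "recenter (h \<circ> v) \<circ> cmap h"])
      (auto simp: rhom_comp rhom_cmap rhom_recenter h cmap_Cst cmap_X recenter_X rhom_add[OF rhom_cmap[OF h]]
        rhom_mult[OF rhom_cmap[OF h]])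
  then show ?thesis by simp
qed

text \<open>Translations compose additively once \<open>a 0 = 1\<close>. This splits the move to V +
  T Q into a move to V followed by a move by T Q.\<close>

lemma recenter_recenter:
  assumes "a 0 = 1"
  shows "recenter a (recenter b p) = recenter (\<lambda>i. if i = 0 then b 0 else a i + b i) p"
proof -
  have "(recenter a \<circ> recenter b) p = recenter (\<lambda>i. if i = 0 then b 0 else a i + b i) p"
    by (rule rhom_mpoly_eqI[where f = "recenter a \<circ> recenter b"
          and g = "recenter (\<lambda>i. if i = 0 then b 0 else a i + b i)"])
      (simp_all add: rhom_comp rhom_recenter recenter_X rhom_add[OF rhom_recenter] rhom_mult[OF rhom_recenter]
        assms rhom_1[OF rhom_Cst] rhom_add[OF rhom_Cst] distrib_right add.assoc)
  then show ?thesis by simp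
qed

section \<open>Specialization of linear systems\<close>

text \<open>Since the kernel of \<open>f\<close> lies in that of \<open>g\<close>, the rank of the
  matrix cannot grow when \<open>f\<close> is replaced by \<open>g\<close>, so a nontrivial kernel
  persists. Induction on the columns performs Gaussian elimination without division; hence the
  solution stays in any subring \<open>C\<close> that contains the entries under
  \<open>g\<close>.\<close>

lemma linear_system_transfer:
  fixes M :: "'e \<Rightarrow> 'j \<Rightarrow> 'r::comm_ring_1"
    and f :: "'r \<Rightarrow> 's::idom" and g :: "'r \<Rightarrow> 't::idom"
  assumes f: "rhom f" and g: "rhom g" and ker: "\<And>x. f x = 0 \<Longrightarrow> g x = 0"
    and C: "0 \<in> C" "1 \<in> C" "\<And>x y. x \<in> C \<Longrightarrow> y \<in> C \<Longrightarrow> x + y \<in> C"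
      "\<And>x y. x \<in> C \<Longrightarrow> y \<in> C \<Longrightarrow> x * y \<in> C" "\<And>x. x \<in> C \<Longrightarrow> - x \<in> C"
    and J: "finite J" and MC: "\<And>e j. j \<in> J \<Longrightarrow> g (M e j) \<in> C"
    and y: "\<exists>j\<in>J. y j \<noteq> 0" "\<And>e. (\<Sum>j\<in>J. f (M e j) * y j) = 0"
  shows "\<exists>x. (\<forall>j\<in>J. x j \<in> C) \<and> (\<exists>j\<in>J. x j \<noteq> 0) \<and> (\<forall>e. (\<Sum>j\<in>J. g (M e j) * x j) = 0)"
  using J MC y
proof (induction J arbitrary: M y rule: finite_induct)
  case empty
  then show ?case by simp
next
  case (insert n J)
  show ?case
  proof (cases "\<forall>e. g (M e n) = 0")
    \<comment> \<open>A column that becomes zero under \<open>g\<close> is solved by its unit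
      vector.\<close>
    case True
    have "(\<Sum>j\<in>insert n J. g (M e j) * (if j = n then 1 else 0)) = 0" for e
      using True insert.hyps by (simp add: sum.neutral)
    then show ?thesis
      using C by (intro exI[of _ "\<lambda>j. if j = n then 1 else 0"]) auto
  next
    case False
    then obtain e0 where e0: "g (M e0 n) \<noteq> 0" by auto
    with ker have f0: "f (M e0 n) \<noteq> 0" by auto
    \<comment> \<open>Two-by-two minors with pivot \<open>M e0 n\<close> eliminate column
      \<open>n\<close> inside the original ring. The pivot is nonzero under \<open>g\<close>, hence
      also under \<open>f\<close>, so the elimination is faithful on both sides.\<close>
    define M' where "M' e j = M e0 n * M e j - M e n * M e0 j" for e j
    have eq: "(\<Sum>j\<in>J. f (M e j) * y j) = - (f (M e n) * y n)" for e
      using insert.prems(3)[of e] insert.hyps by (simp add: eq_neg_iff_add_eq_0 add.commute)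
    have "\<exists>j\<in>J. y j \<noteq> 0"
    proof (rule ccontr)
      assume "\<not> (\<exists>j\<in>J. y j \<noteq> 0)"
      with eq[of e0] f0 insert.prems(2) show False by auto
    qed
    moreover have "(\<Sum>j\<in>J. f (M' e j) * y j) = 0" for e
    proof -
      have "(\<Sum>j\<in>J. f (M' e j) * y j) =
          f (M e0 n) * (\<Sum>j\<in>J. f (M e j) * y j) - f (M e n) * (\<Sum>j\<in>J. f (M e0 j) * y j)"
        by (simp add: M'_def rhom_diff[OF f] rhom_mult[OF f] sum_distrib_left sum_subtractf[symmetric]
            algebra_simps)
      then show ?thesis by (simp add: eq)
    qed
    moreover have "g (M' e j) \<in> C" if "j \<in> J" for e j
    proof -
      have "g (M' e j) = g (M e0 n) * g (M e j) + - (g (M e n) * g (M e0 j))"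
        by (simp add: M'_def rhom_diff[OF g] rhom_mult[OF g])
      then show ?thesis
        using C(3)[OF C(4) C(5)[OF C(4)]] insert.prems(1) that by simp
    qed
    ultimately obtain x where x: "\<forall>j\<in>J. x j \<in> C" "\<exists>j\<in>J. x j \<noteq> 0"
      "\<And>e. (\<Sum>j\<in>J. g (M' e j) * x j) = 0"
      using insert.IH[of M' y] by blast
    let ?s = "\<lambda>e. \<Sum>j\<in>J. g (M e j) * x j"
    have s: "g (M e0 n) * ?s e = g (M e n) * ?s e0" for e
      using x(3)[of e]
      by (simp add: M'_def rhom_diff[OF g] rhom_mult[OF g] sum_distrib_left sum_subtractf algebra_simps)
    define z where "z j = (if j = n then - ?s e0 else g (M e0 n) * x j)" for j
    have "(\<Sum>j\<in>insert n J. g (M e j) * z j) = 0" for e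
    proof -
      have "(\<Sum>j\<in>J. g (M e j) * z j) = (\<Sum>j\<in>J. g (M e0 n) * (g (M e j) * x j))"
        using insert.hyps by (intro sum.cong) (auto simp: z_def)
      also have "\<dots> = g (M e n) * ?s e0"
        using s[of e] by (simp add: sum_distrib_left)
      finally show ?thesis using insert.hyps by (simp add: z_def)
    qed
    moreover have "\<exists>j\<in>insert n J. z j \<noteq> 0"
      using x(2) e0 insert.hyps by (auto simp: z_def)
    moreover have "z j \<in> C" if "j \<in> insert n J" for j
    proof -
      have "?s e0 \<in> C"
      proof -
        have "(\<Sum>j\<in>A. g (M e0 j) * x j) \<in> C" if "A \<subseteq> J" for A
          using finite_subset[OF that insert.hyps(1)] that
        proof (induction A rule: finite_induct)
          case (insert a A)
          then show ?case using C insert.prems x(1) \<open>\<And>e j. j \<in> insert n J \<Longrightarrow> g (M e j) \<in> C\<close> by auto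
        qed (use C in simp)
        then show ?thesis by blast
      qed
      then show ?thesis using C insert.prems(1) x(1) that by (auto simp: z_def)
    qed
    ultimately show ?thesis by blast
  qed
qed

section \<open>Factor theorem, and weighted order and degree through a grading parameter\<close>

definition as_poly :: "nat \<Rightarrow> 'a::comm_ring_1 mpoly \<Rightarrow> 'a mpoly poly" where
  "as_poly n = subst (\<lambda>c. [:Cst c:]) (\<lambda>i. if i = n then [:0, 1:] else [:X i:])"

lemma rhom_const_poly: "rhom h \<Longrightarrow> rhom (\<lambda>c. [:h c:])"
  by (auto simp: rhom_def one_pCons)

lemma rhom_poly: "rhom (\<lambda>p. poly p c)"
  by (auto simp: rhom_def)

lemma poly_as_poly: "poly (as_poly n f) c = subst Cst (X(n := c)) f"
proof -
  note 1 = rhom_const_poly[OF rhom_Cst]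
  have 2: "rhom (as_poly n :: 'a mpoly \<Rightarrow> _)"
    unfolding as_poly_def by (intro rhom_subst 1)
  have "((\<lambda>p. poly p c) \<circ> as_poly n) f = subst Cst (X(n := c)) f"
    by (rule rhom_mpoly_eqI[where g = "subst Cst (X(n := c))", OF rhom_comp[OF rhom_poly 2]])
      (auto simp: as_poly_def rhom_comp rhom_subst 1 rhom_poly rhom_Cst subst_Cst subst_X)
  then show ?thesis by simp
qed

text \<open>Root-factor division of \<open>as_poly n f\<close>, followed by evaluation at
  \<open>X n\<close>, which turns \<open>as_poly n f\<close> back into \<open>f\<close>.\<close>

lemma factor_theorem:
  fixes f :: "'a::idom mpoly"
  assumes "subst Cst (X(n := c)) f = 0"
  obtains g where "f = (X n - c) * g"
proof -
  from assms have "poly (as_poly n f) c = 0" by (simp add: poly_as_poly)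
  then obtain G where G: "as_poly n f = [:- c, 1:] * G"
    by (auto simp: poly_eq_0_iff_dvd)
  have "f = subst Cst X f" by (simp add: subst_Cst_X)
  also have "\<dots> = subst Cst (X(n := X n)) f" by simp
  also have "\<dots> = poly (as_poly n f) (X n)" by (simp only: poly_as_poly)
  also have "\<dots> = (X n - c) * poly G (X n)" by (simp add: G left_diff_distrib)
  finally show ?thesis using that by blast
qed

text \<open>The substitution \<open>X i\<close> to T^(w i) \<open>X i\<close>: the coefficient of
  T^n is the part of weight n. Weighted order and weighted degree become divisibility by a power of
  T and degree in T, and inherit their multiplicativity over a domain.\<close>

definition graded_poly :: "(nat \<Rightarrow> nat) \<Rightarrow> 'a::comm_ring_1 mpoly \<Rightarrow> 'a mpoly poly" where
  "graded_poly w = subst (\<lambda>c. [:Cst c:]) (\<lambda>i. monom (X i) (w i))"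

lemma rhom_graded_poly: "rhom (graded_poly w)"
  unfolding graded_poly_def by (intro rhom_subst rhom_const_poly rhom_Cst)

lemma graded_poly_X: "graded_poly w (X i) = monom (X i) (w i)"
  by (simp add: graded_poly_def subst_X rhom_const_poly rhom_Cst)

lemma monev_monom: "monev (\<lambda>i. monom (v i) (w i)) t = monom (monev v t) (wdeg w t)"
proof -
  have "(\<Prod>i\<in>A. monom (v i) (w i) ^ lookup t i) =
      monom (\<Prod>i\<in>A. v i ^ lookup t i) (\<Sum>i\<in>A. w i * lookup t i)" if "finite A" for A
    using that by (induction A) (auto simp: monom_power mult_monom monom_0 one_pCons mult.commute)
  then show ?thesis by (simp add: monev_def wdeg_def)
qed

lemma lookup_coeff_graded_poly:
  "lookup (coeff (graded_poly w f) n) t = (if wdeg w t = n then lookup f t else 0)"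
proof (induction f rule: mpoly_induct)
  case (single s c)
  have "graded_poly w (single s c) = [:Cst c:] * monom (single s 1) (wdeg w s)"
    by (simp add: graded_poly_def subst_single rhom_const_poly rhom_Cst monev_monom monev_X)
  then show ?case
    by (simp add: Cst_def mult_single lookup_single when_def)
next
  case (add p q)
  then show ?case by (simp add: rhom_add[OF rhom_graded_poly] lookup_add)
qed

lemma graded_poly_eq_0_iff [simp]: "graded_poly w f = 0 \<longleftrightarrow> f = 0"
proof
  assume "graded_poly w f = 0"
  then have "lookup f t = 0" for t
    using lookup_coeff_graded_poly[of w f "wdeg w t" t] by simp
  then show "f = 0" by (intro poly_mapping_eqI) simp
qed (simp add: rhom_0[OF rhom_graded_poly])

lemma graded_poly_monom_dvd_iff:
  "monom 1 a dvd graded_poly w f \<longleftrightarrow> (\<forall>t\<in>keys f. a \<le> wdeg w t)"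
proof -
  have "(\<forall>k<a. coeff (graded_poly w f) k = 0) \<longleftrightarrow> (\<forall>t\<in>keys f. a \<le> wdeg w t)"
    by (auto simp: poly_mapping_eq_iff fun_eq_iff lookup_coeff_graded_poly in_keys_iff not_le[symmetric])
  then show ?thesis by (simp add: monom_1_dvd_iff')
qed

lemma wdeg_le_degree_graded_poly:
  assumes "t \<in> keys f" shows "wdeg w t \<le> degree (graded_poly w f)"
proof (rule le_degree)
  show "coeff (graded_poly w f) (wdeg w t) \<noteq> 0"
    using assms lookup_coeff_graded_poly[of w f "wdeg w t" t] by (auto simp: in_keys_iff)
qed

lemma degree_graded_poly_attained:
  assumes "f \<noteq> 0"
  obtains t where "t \<in> keys f" "wdeg w t = degree (graded_poly w f)"
proof -
  have "coeff (graded_poly w f) (degree (graded_poly w f)) \<noteq> 0"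
    using assms by simp
  then obtain t where "lookup (coeff (graded_poly w f) (degree (graded_poly w f))) t \<noteq> 0"
    by (metis lookup_zero poly_mapping_eqI)
  then show ?thesis
    using that by (auto simp: lookup_coeff_graded_poly in_keys_iff split: if_splits)
qed

section \<open>Vanishing on the grid\<close>

definition grid_point :: "nat set \<Rightarrow> nat \<Rightarrow> 'a::comm_ring_1" where
  "grid_point Q i = of_bool (i = 0 \<or> i \<in> Q)"

definition kill :: "nat \<Rightarrow> 'a::comm_ring_1 mpoly \<Rightarrow> 'a mpoly" where
  "kill n = subst Cst (X(n := 0))"

lemma rhom_kill: "rhom (kill n)"
  unfolding kill_def by (intro rhom_subst rhom_Cst)

lemma kill_Cst: "kill n (Cst c) = Cst c"
  by (simp add: kill_def subst_Cst rhom_Cst)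

lemma kill_X: "kill n (X i) = (if i = n then 0 else X i)"
  by (simp add: kill_def subst_X rhom_Cst)

lemma lookup_kill: "lookup (kill n f) t = (if n \<in> keys t then 0 else lookup f t)"
proof (induction f rule: mpoly_induct)
  case (single s c)
  have "kill n (single s c) = Cst c * monev (X(n := 0)) s"
    by (simp add: kill_def subst_single rhom_Cst)
  moreover have "monev (X(n := 0)) s = (if n \<in> keys s then 0 else single s (1 :: 'a))"
  proof (cases "n \<in> keys s")
    case True
    then show ?thesis by (auto simp: monev_def in_keys_iff zero_power intro!: prod_zero bexI[of _ n])
  next
    case False
    then have "monev (X(n := 0)) s = (monev X s :: 'a mpoly)" by (intro monev_cong) auto
    then show ?thesis using False by (simp add: monev_X)
  qed
  ultimately show ?case by (auto simp: lookup_single when_def)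
next
  case (add p q)
  then show ?case by (simp add: rhom_add[OF rhom_kill] lookup_add)
qed

lemma keys_kill: "keys (kill n f) = {t \<in> keys f. n \<notin> keys t}"
  by (auto simp: in_keys_iff[of _ "kill n f"] in_keys_iff[of _ f] lookup_kill split: if_splits)

lemma wdeg_grid_weight_insert: "n \<notin> keys t \<Longrightarrow> wdeg (grid_weight (insert n S)) t = wdeg (grid_weight S) t"
  by (auto simp: wdeg_def grid_weight_def of_bool_def intro!: sum.cong)

text \<open>The first factor has order exactly 1 in T and the second is nonzero at T = 0. This is
  the local shape of x_n (x_n - x_0) at a grid point, which lies on exactly one of the two
  hyperplanes.\<close>

lemma monom_dvd_cancel:
  fixes P :: "'a::idom poly"
  assumes "monom 1 (Suc m) dvd [:0, b:] * [:a, b:] * P" "a \<noteq> 0" "b \<noteq> 0"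
  shows "monom 1 m dvd P"
proof (cases "P = 0")
  case False
  have 1: "Polynomial.order 0 [:a, b:] = 0" using assms(2) by (simp add: order_0I)
  have 2: "[:0, b:] = monom b 1" by (simp add: monom_Suc monom_0)
  have o1: "Polynomial.order 0 [:0, b:] = 1" using assms(3) unfolding 2 by (simp add: order_0_monom)
  have nz: "[:0, b:] \<noteq> 0" "[:a, b:] * P \<noteq> 0"
    using False assms(2,3) by (auto simp del: mult_pCons_left)
  then have "[:0, b:] * ([:a, b:] * P) \<noteq> 0" by (rule no_zero_divisors)
  from Polynomial.order_mult[OF this, of 0] Polynomial.order_mult[OF nz(2), of 0] 1 o1
  have "Polynomial.order 0 ([:0, b:] * [:a, b:] * P) = Suc (Polynomial.order 0 P)"
    by (simp only: mult.assoc plus_1_eq_Suc add_0)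
  moreover have "Suc m \<le> Polynomial.order 0 ([:0, b:] * [:a, b:] * P)"
    using assms(1) nz by (subst monom_1_dvd_iff[symmetric]) (auto simp: mult.assoc simp del: mult_pCons_left)
  ultimately show ?thesis using False by (simp add: monom_1_dvd_iff)
qed simp

text \<open>As variable 0 has weight 0, each substituted form \<open>recenter_vars v i\<close> has
  weighted degree at most \<open>w i\<close>. So translations do not raise the affine
  degree.\<close>

lemma degree_recenter_le:
  fixes f :: "'a::idom mpoly"
  assumes w: "w 0 = 0" and f: "f \<noteq> 0" and t: "t \<in> keys (recenter v f)"
  shows "wdeg w t \<le> degree (graded_poly w f)"
proof -
  define D where "D = degree (graded_poly w f)"
  have rg: "rhom (graded_poly w :: 'a mpoly \<Rightarrow> _)" by (rule rhom_graded_poly)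
  have var: "degree (graded_poly w (recenter_vars v i)) \<le> w i" for i
  proof -
    have C: "graded_poly w (Cst c) = [:Cst c:]" for c :: 'a
      by (simp add: graded_poly_def subst_Cst rhom_const_poly rhom_Cst)
    show ?thesis
      by (auto simp: recenter_vars_def rhom_mult[OF rg] rhom_add[OF rg] C graded_poly_X w monom_0
          intro!: degree_add_le degree_monom_le order.trans[OF degree_smult_le])
  qed
  have mv: "degree (graded_poly w (monev (recenter_vars v) s)) \<le> wdeg w s" for s
  proof -
    have "degree (\<Prod>i\<in>A. graded_poly w (recenter_vars v i) ^ lookup s i) \<le> (\<Sum>i\<in>A. w i * lookup s i)"
      if "finite A" for A
      using that
    proof (induction A)
      case (insert i A)
      have "degree (graded_poly w (recenter_vars v i) ^ lookup s i) \<le> w i * lookup s i"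
        using degree_power_le[of "graded_poly w (recenter_vars v i)" "lookup s i"]
          mult_right_mono[OF var[of i], of "lookup s i"] by linarith
      then show ?case
        using insert by (auto intro!: order.trans[OF degree_mult_le] add_mono)
    qed simp
    then show ?thesis by (simp add: monev_def wdeg_def rhom_prod[OF rg] rhom_power[OF rg])
  qed
  have "graded_poly w (recenter v f) =
      (\<Sum>s\<in>keys f. [:Cst (lookup f s):] * graded_poly w (monev (recenter_vars v) s))"
    by (simp add: recenter_def subst_def rhom_sum[OF rg] rhom_mult[OF rg])
      (simp add: graded_poly_def subst_Cst rhom_const_poly rhom_Cst)
  also have "degree \<dots> \<le> D"
  proof (rule degree_sum_le)
    fix s assume "s \<in> keys f"
    then show "degree ([:Cst (lookup f s):] * graded_poly w (monev (recenter_vars v) s)) \<le> D"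
      using mv[of s] wdeg_le_degree_graded_poly[of s f w] degree_smult_le unfolding D_def
      by (auto intro: order.trans)
  qed simp
  finally show ?thesis
    using wdeg_le_degree_graded_poly[OF t, of w] by (simp add: D_def)
qed

text \<open>Recentring at a grid point commutes with restriction to the hyperplane x_n = 0 or x_n =
  x_0 through it; in the second case the hyperplane is first moved to x_n = 0. This reduces the grid
  on \<open>insert n Q\<close> to one dimension less.\<close>

lemma kill_recenter_grid:
  assumes "n \<notin> Q" "n \<noteq> 0"
  shows "kill n (recenter (grid_point Q) f) = recenter (grid_point Q) (kill n f)"
    and "kill n (recenter (grid_point (insert n Q)) f) =
      recenter (grid_point Q) (kill n (recenter (grid_point {n}) f))"
proof -
  note simps = rhom_comp rhom_kill rhom_recenter kill_Cst kill_X recenter_X rhom_add[OF rhom_kill]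
    rhom_mult[OF rhom_kill] rhom_add[OF rhom_recenter] rhom_mult[OF rhom_recenter] grid_point_def
    rhom_0[OF rhom_kill] rhom_0[OF rhom_recenter] rhom_0[OF rhom_Cst] rhom_1[OF rhom_Cst]
  have "(kill n \<circ> recenter (grid_point Q)) f = (recenter (grid_point Q) \<circ> kill n) f"
    by (rule rhom_mpoly_eqI[where f = "kill n \<circ> recenter (grid_point Q)"
          and g = "recenter (grid_point Q) \<circ> kill n"]) (use assms in \<open>auto simp: simps\<close>)
  then show "kill n (recenter (grid_point Q) f) = recenter (grid_point Q) (kill n f)" by simp
  have "(kill n \<circ> recenter (grid_point (insert n Q))) f =
      (recenter (grid_point Q) \<circ> (kill n \<circ> recenter (grid_point {n}))) f"
    by (rule rhom_mpoly_eqI[where f = "kill n \<circ> recenter (grid_point (insert n Q))"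
          and g = "recenter (grid_point Q) \<circ> (kill n \<circ> recenter (grid_point {n}))"])
      (use assms in \<open>auto simp: simps\<close>)
  then show "kill n (recenter (grid_point (insert n Q)) f) =
      recenter (grid_point Q) (kill n (recenter (grid_point {n}) f))" by simp
qed

lemma kill_recenter_single:
  assumes "n \<noteq> 0"
  shows "kill n (recenter (grid_point {n}) f) = subst Cst (X(n := X 0)) f"
proof -
  have "(kill n \<circ> recenter (grid_point {n})) f = subst Cst (X(n := X 0)) f"
    by (rule rhom_mpoly_eqI[where f = "kill n \<circ> recenter (grid_point {n})" and g = "subst Cst (X(n := X 0))"])
      (use assms in \<open>auto simp: rhom_comp rhom_kill rhom_recenter kill_Cst kill_X recenter_X
        rhom_add[OF rhom_kill] rhom_mult[OF rhom_kill] grid_point_def rhom_1[OF rhom_Cst]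
        rhom_0[OF rhom_Cst] rhom_subst rhom_Cst subst_Cst subst_X\<close>)
  then show ?thesis by simp
qed

text \<open>Outer induction on the dimension, inner induction on \<open>m\<close>. If the
  restriction to x_n = 0 or to x_n = x_0 is nonzero, the smaller grid bounds its degree. Otherwise
  x_n (x_n - x_0) divides \<open>f\<close>; dividing it out lowers the degree by 2 and the order at
  each grid point by 1. In dimension 0 a nonzero \<open>f\<close> has order 0.\<close>

lemma grid_vanishing_degree:
  fixes f :: "'a::idom mpoly"
  assumes "finite S" "0 \<notin> S" "f \<noteq> 0"
    and "\<And>Q. Q \<subseteq> S \<Longrightarrow> monom 1 m dvd graded_poly (grid_weight S) (recenter (grid_point Q) f)"
  shows "2 * m \<le> degree (graded_poly (grid_weight S) f)"
  using assms
proof (induction S arbitrary: f m rule: finite_induct)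
  case empty
  have "recenter (grid_point {}) f = f"
    by (rule rhom_mpoly_eqI[where f = "recenter (grid_point {})" and g = "\<lambda>p. p"])
      (auto simp: rhom_recenter rhom_id recenter_X grid_point_def rhom_0[OF rhom_Cst] rhom_1[OF rhom_Cst])
  then have "\<forall>t\<in>keys f. m \<le> wdeg (grid_weight {}) t"
    using empty.prems(3)[of "{}"] by (simp add: graded_poly_monom_dvd_iff)
  moreover have "wdeg (grid_weight {}) t = 0" for t
    by (simp add: wdeg_def grid_weight_def)
  moreover have "keys f \<noteq> {}" using empty.prems(2) by simp
  ultimately show ?case by auto
next
  case (insert n S)
  note outer = insert.IH
  let ?w = "grid_weight (insert n S)"
  have n: "n \<noteq> 0" "0 \<notin> S" "n \<notin> S" using insert by auto
  have kill_dvd: "monom 1 m dvd graded_poly (grid_weight S) (kill n p)"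
    if "monom 1 m dvd graded_poly ?w p" for m and p :: "'a mpoly"
    using that by (auto simp: graded_poly_monom_dvd_iff keys_kill wdeg_grid_weight_insert)
  show ?case using insert.prems(2,3)
  proof (induction m arbitrary: f)
    case (Suc m f)
    let ?f1 = "subst Cst (X(n := X 0)) f"
    consider "kill n f \<noteq> 0" | "?f1 \<noteq> 0" | "kill n f = 0" "?f1 = 0" by blast
    then show ?case
    proof cases
      case 1
      have "monom 1 (Suc m) dvd graded_poly (grid_weight S) (recenter (grid_point Q) (kill n f))"
        if "Q \<subseteq> S" for Q
      proof -
        have "n \<notin> Q" using that n by auto
        then show ?thesis
          using kill_dvd[OF Suc.prems(2)[of Q]] that n by (simp add: kill_recenter_grid(1) subset_insertI2)
      qed
      then have "2 * Suc m \<le> degree (graded_poly (grid_weight S) (kill n f))"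
        using outer[OF n(2) 1] by blast
      moreover obtain t where t: "t \<in> keys (kill n f)"
        "wdeg (grid_weight S) t = degree (graded_poly (grid_weight S) (kill n f))"
        using degree_graded_poly_attained[OF 1] by blast
      moreover have "wdeg (grid_weight S) t = wdeg ?w t" "t \<in> keys f"
        using t(1) by (auto simp: keys_kill wdeg_grid_weight_insert)
      ultimately show ?thesis
        using wdeg_le_degree_graded_poly[of t f ?w] by simp
    next
      case 2
      have f1: "?f1 = kill n (recenter (grid_point {n}) f)"
        using n by (simp add: kill_recenter_single)
      have "monom 1 (Suc m) dvd graded_poly (grid_weight S) (recenter (grid_point Q) ?f1)"
        if "Q \<subseteq> S" for Q
      proof -
        have "n \<notin> Q" using that n by auto
        then show ?thesis
          using kill_dvd[OF Suc.prems(2)[of "insert n Q"]] that n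
          by (metis f1 kill_recenter_grid(2) insert_mono)
      qed
      then have "2 * Suc m \<le> degree (graded_poly (grid_weight S) ?f1)"
        using outer[OF n(2) 2] by blast
      moreover obtain t where t: "t \<in> keys ?f1"
        "wdeg (grid_weight S) t = degree (graded_poly (grid_weight S) ?f1)"
        using degree_graded_poly_attained[OF 2] by blast
      moreover have "wdeg (grid_weight S) t = wdeg ?w t" "t \<in> keys (recenter (grid_point {n}) f)"
        using t(1) by (auto simp: f1 keys_kill wdeg_grid_weight_insert)
      moreover have "?w 0 = 0" using n by (simp add: grid_weight_def)
      ultimately show ?thesis
        using degree_recenter_le[OF _ Suc.prems(1), of ?w t "grid_point {n}"] by simp
    next
      case 3
      obtain g where g: "f = (X n - 0) * g"
        using factor_theorem[of n 0 f] 3(1) unfolding kill_def by metis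
      have X0: "X i \<noteq> (0 :: 'a mpoly)" for i
        by (metis X_def keys_single keys_zero one_neq_zero insert_not_empty)
      have "?f1 = X 0 * subst Cst (X(n := X 0)) g"
        by (simp add: g rhom_mult rhom_subst rhom_Cst subst_X)
      then have "subst Cst (X(n := X 0)) g = 0" using 3(2) X0 by simp
      then obtain g' where g': "g = (X n - X 0) * g'" by (rule factor_theorem)
      have f: "f = X n * (X n - X 0) * g'" by (simp add: g g' mult.assoc)
      have g'0: "g' \<noteq> 0" using f Suc.prems(1) by auto
      have rg: "rhom (graded_poly ?w :: 'a mpoly \<Rightarrow> _)" by (rule rhom_graded_poly)
      have gX: "graded_poly ?w (X n) = [:0, X n :: 'a mpoly:]" "graded_poly ?w (X 0) = [:X 0 :: 'a mpoly:]"
        using n by (simp_all add: graded_poly_X grid_weight_def monom_Suc monom_0)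
      have "monom 1 m dvd graded_poly ?w (recenter (grid_point Q) g')" if "Q \<subseteq> insert n S" for Q
      proof -
        have rr: "rhom (recenter (grid_point Q) :: 'a mpoly \<Rightarrow> _)" by (rule rhom_recenter)
        \<comment> \<open>For \<open>n\<close> in \<open>Q\<close> the factor x_n - x_0 becomes
          \<open>X n\<close> and x_n becomes \<open>X n + X 0\<close>; for \<open>n\<close> outside
          \<open>Q\<close>, x_n stays and the other factor is \<open>X n - X 0\<close>.\<close>
        define e :: "'a mpoly" where "e = (if n \<in> Q then X 0 else - X 0)"
        have "recenter (grid_point Q) (X n * (X n - X 0)) = X n * (X n + e)"
          using n by (auto simp: e_def rhom_mult[OF rr] rhom_diff[OF rr] recenter_X grid_point_def
              rhom_0[OF rhom_Cst] rhom_1[OF rhom_Cst] algebra_simps)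
        then have "graded_poly ?w (recenter (grid_point Q) f) =
            graded_poly ?w (X n * (X n + e)) * graded_poly ?w (recenter (grid_point Q) g')"
          by (simp only: f rhom_mult[OF rr] rhom_mult[OF rg])
        also have "graded_poly ?w (X n * (X n + e)) = [:0, X n:] * [:e, X n:]"
          by (auto simp: e_def rhom_mult[OF rg] rhom_add[OF rg] rhom_diff[OF rg] rhom_minus[OF rg] gX)
        finally show ?thesis
          using Suc.prems(2)[OF that] monom_dvd_cancel[of m "X n" e] X0 by (auto simp: e_def)
      qed
      then have "2 * m \<le> degree (graded_poly ?w g')" using Suc.IH[OF g'0] by blast
      moreover have "graded_poly ?w f = [:0, X n:] * [:- X 0, X n:] * graded_poly ?w g'"
        by (simp add: f rhom_mult[OF rg] rhom_diff[OF rg] gX)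
      then have "degree (graded_poly ?w f) = 2 + degree (graded_poly ?w g')"
        using g'0 X0 by (simp add: degree_mult_eq del: mult_pCons_left mult_pCons_right)
      ultimately show ?thesis by simp
    qed
  qed simp
qed

section \<open>Collision of points on a grid\<close>

abbreviation (input) at_zero :: "'a::comm_ring_1 poly \<Rightarrow> 'a" where
  "at_zero \<equiv> \<lambda>p. poly p 0"

text \<open>The exponent \<open>e\<close> is the least T-order among all coefficients, so the
  quotient survives T = 0. The limit consists of the T^e-coefficients, so it has no monomials
  outside those of \<open>P\<close>.\<close>

lemma factor_out_parameter:
  fixes P :: "'a::idom poly mpoly"
  assumes "P \<noteq> 0"
  obtains e H where "P = Cst (monom 1 e) * H" "cmap at_zero H \<noteq> 0"
    "\<And>u. lookup (cmap at_zero H) u = coeff (lookup P u) e"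
    "\<And>u n. coeff (lookup P u) n \<noteq> 0 \<Longrightarrow> e \<le> n"
proof -
  define e where "e = (LEAST n. \<exists>u. coeff (lookup P u) n \<noteq> 0)"
  have "\<exists>n u. coeff (lookup P u) n \<noteq> 0"
    using assms by (auto simp: poly_mapping_eq_iff fun_eq_iff poly_eq_iff)
  then have e1: "\<exists>u. coeff (lookup P u) e \<noteq> 0"
    unfolding e_def by (rule LeastI_ex)
  have e2: "e \<le> n" if "coeff (lookup P u) n \<noteq> 0" for u n
    unfolding e_def using that by (intro Least_le) auto
  define H where "H = Poly_Mapping.map (poly_shift e) P"
  have lH: "lookup H u = poly_shift e (lookup P u)" for u
    by (simp add: H_def Poly_Mapping.map.rep_eq when_def)
  have "P = Cst (monom 1 e) * H"
  proof (rule poly_mapping_eqI)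
    fix u
    show "lookup P u = lookup (Cst (monom 1 e) * H) u"
    proof (rule poly_eqI)
      fix n
      show "coeff (lookup P u) n = coeff (lookup (Cst (monom 1 e) * H) u) n"
        using e2[of u n] by (cases "n < e") (auto simp: lH coeff_monom_mult coeff_poly_shift)
    qed
  qed
  moreover have l0: "lookup (cmap at_zero H) u = coeff (lookup P u) e" for u
    unfolding lookup_cmap[OF rhom_poly] by (simp add: lH poly_0_coeff_0 coeff_poly_shift)
  moreover have "cmap at_zero H \<noteq> 0" using e1 l0 by (metis lookup_zero)
  ultimately show ?thesis using e2 that by blast
qed

text \<open>With c = T this is the blow-up substitution y to T y. With c = 0 it keeps exactly the
  terms of \<open>ydeg\<close> 0.\<close>

definition scale :: "nat \<Rightarrow> 'a::comm_ring_1 \<Rightarrow> 'a mpoly \<Rightarrow> 'a mpoly" where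
  "scale N c = subst Cst (\<lambda>i. Cst (c ^ grid_weight {1..N} i) * X i)"

lemma rhom_scale: "rhom (scale N c)"
  unfolding scale_def by (intro rhom_subst rhom_Cst)

lemma lookup_scale: "lookup (scale N c p) t = c ^ ydeg N t * lookup p t"
proof (induction p rule: mpoly_induct)
  case (single s d)
  have "monev (\<lambda>i. Cst (c ^ grid_weight {1..N} i)) s = Cst (c ^ ydeg N s)"
    using monev_rhom[OF rhom_Cst, of "\<lambda>i. c ^ grid_weight {1..N} i" s]
    by (simp add: monev_power ydeg_def comp_def)
  then show ?case
    by (simp add: scale_def subst_single rhom_Cst monev_mult monev_X lookup_single when_def)
next
  case (add p q)
  then show ?case by (simp add: rhom_add[OF rhom_scale] lookup_add distrib_left)
qed

text \<open>Conjugating the translation by c Q with the scaling by c gives the translation by Q: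
  this is how the colliding points become fixed.\<close>

lemma scale_recenter:
  assumes "Q \<subseteq> {1..N}"
  shows "scale N c (recenter (\<lambda>i. if i = 0 then 1 else if i \<in> Q then c else 0) p) =
    recenter (grid_point Q) (scale N c p)"
proof -
  let ?r = "recenter (\<lambda>i. if i = 0 then 1 else if i \<in> Q then c else 0)"
  have Q: "i \<in> Q \<Longrightarrow> 1 \<le> i \<and> i \<le> N" for i using assms by auto
  have sX: "scale N c (X i) = Cst (c ^ grid_weight {1..N} i) * X i" for i
    by (simp add: scale_def subst_X rhom_Cst)
  have sC: "scale N c (Cst d) = Cst d" for d
    by (simp add: scale_def subst_Cst rhom_Cst)
  have "(scale N c \<circ> ?r) p = (recenter (grid_point Q) \<circ> scale N c) p"
  proof (rule rhom_mpoly_eqI[where f = "scale N c \<circ> ?r" and g = "recenter (grid_point Q) \<circ> scale N c"])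
    fix i show "(scale N c \<circ> ?r) (X i) = (recenter (grid_point Q) \<circ> scale N c) (X i)"
      using Q[of i]
      by (auto simp: recenter_X sX sC rhom_add[OF rhom_scale] rhom_mult[OF rhom_scale]
          rhom_add[OF rhom_recenter] rhom_mult[OF rhom_recenter] grid_point_def grid_weight_def
          rhom_0[OF rhom_Cst] rhom_1[OF rhom_Cst] distrib_left)
  qed (auto simp: rhom_comp rhom_scale rhom_recenter sC)
  then show ?thesis by simp
qed

lemma yord_ge_graded_poly: "yord_ge N a p \<longleftrightarrow> monom 1 a dvd graded_poly (grid_weight {1..N}) p"
  by (simp add: yord_ge_def ydeg_def graded_poly_monom_dvd_iff)

lemma yord_ge_cmap:
  assumes "rhom h" "yord_ge N a p" shows "yord_ge N a (cmap h p)"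
  using assms by (simp add: yord_ge_iff lookup_cmap rhom_0)

lemma yord_ge_Cst_mult_iff:
  fixes c :: "'a::idom"
  assumes "c \<noteq> 0" shows "yord_ge N a (Cst c * p) \<longleftrightarrow> yord_ge N a p"
  using assms by (simp add: yord_ge_iff)

text \<open>Blowing up at \<open>V\<close>: substituting \<open>y \<rightarrow> T y\<close> after moving \<open>V\<close> to the origin turns the colliding
  points \<open>V + T Q\<close> into the fixed grid points \<open>Q\<close>, and the leading coefficient in \<open>T\<close> is a form of
  degree at most the order of \<open>F\<close> at \<open>V\<close> for \<open>T = 0\<close>.\<close>
lemma collision:
  fixes F :: "'a::idom poly mpoly"
  assumes "\<And>Q. Q \<subseteq> {1..N} \<Longrightarrow> yord_ge N m (recenter (\<lambda>i. [:V i, of_bool (i \<in> Q):]) F)"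
  shows "yord_ge N (2 * m) (recenter V (cmap at_zero F))"
proof (rule ccontr)
  assume contr: "\<not> ?thesis"
  define T :: "'a poly" where "T = monom 1 1"
  have T: "T = [:0, 1:]" by (simp add: T_def monom_Suc monom_0)
  have Tn: "T ^ n = monom 1 n" for n by (simp add: T_def monom_power)
  define G where "G = recenter (\<lambda>i. [:V i:]) F"
  have "recenter V (cmap at_zero F) = cmap at_zero G"
    by (simp add: G_def cmap_recenter[OF rhom_poly] comp_def)
  \<comment> \<open>A term of too low order at V that survives T = 0. After y to T y its coefficient
    has T-order exactly \<open>ydeg N u0\<close>, which bounds the extracted power of T.\<close>
  with contr obtain u0 where u0: "ydeg N u0 < 2 * m" "poly (lookup G u0) 0 \<noteq> 0"
    by (auto simp: yord_ge_iff lookup_cmap[OF rhom_poly])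
  define P where "P = scale N T G"
  have lP: "coeff (lookup P u) n = (if ydeg N u \<le> n then coeff (lookup G u) (n - ydeg N u) else 0)"
    for u n
    by (simp add: P_def lookup_scale Tn coeff_monom_mult)
  have u0': "coeff (lookup P u0) (ydeg N u0) \<noteq> 0"
    using u0(2) by (simp add: lP poly_0_coeff_0)
  then have "P \<noteq> 0" by auto
  then obtain e H where H: "P = Cst (monom 1 e) * H" "cmap at_zero H \<noteq> 0"
    "\<And>u. lookup (cmap at_zero H) u = coeff (lookup P u) e"
    "\<And>u n. coeff (lookup P u) n \<noteq> 0 \<Longrightarrow> e \<le> n"
    by (rule factor_out_parameter) blast
  define H0 where "H0 = cmap at_zero H"
  have "yord_ge N m (recenter (grid_point Q) H0)" if Q: "Q \<subseteq> {1..N}" for Q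
  proof -
    have "0 \<notin> Q" using Q by auto
    then have "(\<lambda>i. if i = 0 then [:V 0:] else (if i = 0 then 1 else if i \<in> Q then T else 0) + [:V i:])
        = (\<lambda>i. [:V i, of_bool (i \<in> Q):])"
      by (auto simp: T fun_eq_iff)
    then have "recenter (\<lambda>i. if i = 0 then 1 else if i \<in> Q then T else 0) G =
        recenter (\<lambda>i. [:V i, of_bool (i \<in> Q):]) F"
      unfolding G_def by (subst recenter_recenter) auto
    then have "yord_ge N m (recenter (\<lambda>i. if i = 0 then 1 else if i \<in> Q then T else 0) G)"
      using assms[OF Q] by simp
    then have "yord_ge N m (scale N T (recenter (\<lambda>i. if i = 0 then 1 else if i \<in> Q then T else 0) G))"
      by (simp add: yord_ge_iff lookup_scale)
    then have "yord_ge N m (recenter (grid_point Q) P)"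
      by (simp add: scale_recenter[OF Q] P_def)
    then have "yord_ge N m (recenter (grid_point Q) H)"
      by (simp add: H(1) rhom_mult[OF rhom_recenter] yord_ge_Cst_mult_iff)
    then have "yord_ge N m (cmap at_zero (recenter (grid_point Q) H))"
      by (rule yord_ge_cmap[OF rhom_poly])
    moreover have "at_zero \<circ> grid_point Q = (grid_point Q :: nat \<Rightarrow> 'a)"
      by (auto simp: grid_point_def fun_eq_iff of_bool_def)
    ultimately show ?thesis
      by (simp add: H0_def cmap_recenter[OF rhom_poly])
  qed
  then have "2 * m \<le> degree (graded_poly (grid_weight {1..N}) H0)"
    using H(2) by (intro grid_vanishing_degree) (auto simp: yord_ge_graded_poly H0_def)
  moreover obtain t where t: "t \<in> keys H0" "ydeg N t = degree (graded_poly (grid_weight {1..N}) H0)"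
    using degree_graded_poly_attained[of H0 "grid_weight {1..N}"] H(2) unfolding H0_def ydeg_def by blast
  \<comment> \<open>The scaled coefficient of \<open>t\<close> is divisible by
    T^(\<open>ydeg N t\<close>), so it can reach the T^e-part only if its degree is at most
    \<open>e\<close>. The contradiction is 2 m <= \<open>ydeg N t\<close> <= e <=
    \<open>ydeg N u0\<close> < 2 m.\<close>
  moreover have "ydeg N t \<le> e"
    using t(1) H(3)[of t] by (auto simp: H0_def in_keys_iff lP split: if_splits)
  moreover have "e \<le> ydeg N u0" using H(4)[OF u0'] .
  ultimately show False using u0(1) by simp
qed

text \<open>The matrix of vanishing conditions: a row is a point together with a monomial that must
  disappear after recentring there, a column is a monomial of the unknown form. Pairs that impose no
  condition give zero rows, so rows may range over the whole type.\<close>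

definition fat_system ::
  "nat \<Rightarrow> nat list \<Rightarrow> (nat \<Rightarrow> nat \<Rightarrow> 'a::comm_ring_1) \<Rightarrow> nat \<times> (nat \<Rightarrow>\<^sub>0 nat) \<Rightarrow> (nat \<Rightarrow>\<^sub>0 nat) \<Rightarrow> 'a"
where
  "fat_system N a V = (\<lambda>(i, u) t. if i < length a \<and> ydeg N u < a ! i
     then lookup (recenter (V i) (single t 1)) u else 0)"

definition fat_vanishing :: "nat \<Rightarrow> nat list \<Rightarrow> (nat \<Rightarrow> nat \<Rightarrow> 'a::comm_ring_1) \<Rightarrow> 'a mpoly \<Rightarrow> bool" where
  "fat_vanishing N a V f \<longleftrightarrow> (\<forall>i<length a. yord_ge N (a ! i) (recenter (V i) f))"

lemma lookup_recenter_sum: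
  "lookup (recenter v (\<Sum>t\<in>J. single t (y t))) u = (\<Sum>t\<in>J. lookup (recenter v (single t 1)) u * y t)"
proof -
  have "single t (y t) = Cst (y t) * single t 1" for t
    by (simp add: Cst_def mult_single)
  then have "lookup (recenter v (single t (y t))) u = lookup (recenter v (single t 1)) u * y t" for t
    by (simp add: rhom_mult[OF rhom_recenter] mult.commute)
  then show ?thesis by (simp add: rhom_sum[OF rhom_recenter] lookup_sum)
qed

lemma fat_system_solution_iff:
  "(\<forall>e. (\<Sum>t\<in>J. fat_system N a V e t * y t) = 0) \<longleftrightarrow> fat_vanishing N a V (\<Sum>t\<in>J. single t (y t))"
proof -
  have "(\<Sum>t\<in>J. fat_system N a V (i, u) t * y t) = (if i < length a \<and> ydeg N u < a ! i
      then lookup (recenter (V i) (\<Sum>t\<in>J. single t (y t))) u else 0)" for i u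
    by (cases "i < length a \<and> ydeg N u < a ! i") (auto simp: fat_system_def lookup_recenter_sum)
  then show ?thesis by (auto simp: fat_vanishing_def yord_ge_iff)
qed

lemma fat_system_rhom:
  assumes h: "rhom h" shows "h (fat_system N a V e t) = fat_system N a (\<lambda>i. h \<circ> V i) e t"
proof -
  have "cmap h (single t 1) = single t 1"
    by (rule poly_mapping_eqI) (auto simp: lookup_cmap[OF h] lookup_single when_def rhom_0[OF h] rhom_1[OF h])
  then have "h (lookup (recenter (V i) (single t 1)) u) = lookup (recenter (h \<circ> V i) (single t 1)) u" for i u
    using cmap_recenter[OF h, of "V i" "single t 1"] lookup_cmap[OF h] by metis
  then show ?thesis
    by (cases e) (auto simp: fat_system_def rhom_0[OF h])
qed

lemma lookup_sum_single: "finite J \<Longrightarrow> lookup (\<Sum>t\<in>J. single t (y t)) u = (if u \<in> J then y u else 0)"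
  by (simp add: lookup_sum lookup_single when_def sum.delta')

text \<open>The conditions are linear in the form and natural in the coordinates of the points, so
  \<open>linear_system_transfer\<close> applies. The set \<open>J\<close> of admissible monomials
  preserves the degree; \<open>C\<close> controls where the new coefficients lie.\<close>

lemma fat_vanishing_transfer:
  fixes f :: "'r::comm_ring_1 \<Rightarrow> 's::idom" and g :: "'r \<Rightarrow> 't::idom"
  assumes f: "rhom f" and g: "rhom g" and ker: "\<And>x. f x = 0 \<Longrightarrow> g x = 0"
    and C: "0 \<in> C" "1 \<in> C" "\<And>x y. x \<in> C \<Longrightarrow> y \<in> C \<Longrightarrow> x + y \<in> C"
      "\<And>x y. x \<in> C \<Longrightarrow> y \<in> C \<Longrightarrow> x * y \<in> C" "\<And>x. x \<in> C \<Longrightarrow> - x \<in> C"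
    and J: "finite J"
    and MC: "\<And>t i u. t \<in> J \<Longrightarrow> i < length a \<Longrightarrow> lookup (recenter (g \<circ> V i) (single t 1)) u \<in> C"
    and p: "p \<noteq> 0" "keys p \<subseteq> J" "fat_vanishing N a (\<lambda>i. f \<circ> V i) p"
  shows "\<exists>q. q \<noteq> 0 \<and> keys q \<subseteq> J \<and> (\<forall>t. lookup q t \<in> C) \<and> fat_vanishing N a (\<lambda>i. g \<circ> V i) q"
proof -
  have p_eq: "p = (\<Sum>t\<in>J. single t (lookup p t))"
    using J p(2) by (intro poly_mapping_eqI) (auto simp: lookup_sum_single in_keys_iff)
  have 1: "\<exists>t\<in>J. lookup p t \<noteq> 0"
    using p(1,2) by (metis in_keys_iff keys_eq_empty subset_iff ex_in_conv)
  have 2: "(\<Sum>t\<in>J. f (fat_system N a V e t) * lookup p t) = 0" for e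
    using p(3) fat_system_solution_iff[of N a "\<lambda>i. f \<circ> V i" "lookup p" J]
    by (cases e) (simp add: p_eq[symmetric] fat_system_rhom[OF f])
  have 3: "g (fat_system N a V e t) \<in> C" if "t \<in> J" for e t
    unfolding fat_system_rhom[OF g] using MC[OF that] C(1) by (cases e) (auto simp: fat_system_def)
  have "\<exists>x. (\<forall>t\<in>J. x t \<in> C) \<and> (\<exists>t\<in>J. x t \<noteq> 0) \<and>
      (\<forall>e. (\<Sum>t\<in>J. g (fat_system N a V e t) * x t) = 0)"
    by (rule linear_system_transfer[where f = f and y = "lookup p"]) (fact f g ker C J 3 1 2)+
  then obtain x where x: "\<forall>t\<in>J. x t \<in> C" "\<exists>t\<in>J. x t \<noteq> 0"
    "\<And>e. (\<Sum>t\<in>J. g (fat_system N a V e t) * x t) = 0"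
    by blast
  let ?q = "\<Sum>t\<in>J. single t (x t)"
  have l: "lookup ?q t = (if t \<in> J then x t else 0)" for t
    by (rule lookup_sum_single[OF J])
  have "fat_vanishing N a (\<lambda>i. g \<circ> V i) ?q"
    using x(3) by (simp add: fat_system_solution_iff[symmetric] fat_system_rhom[OF g])
  moreover have "?q \<noteq> 0" using x(2) l by (metis lookup_zero)
  moreover have "keys ?q \<subseteq> J" by (auto simp: in_keys_iff l split: if_splits)
  ultimately show ?thesis using x(1) l C(1) by (intro exI[of _ ?q]) auto
qed

section \<open>From generic points to collided generic points\<close>

text \<open>Needed because \<open>initial_degree\<close> ranges over all nonzero elements of an
  ideal, also inhomogeneous ones; the part of top degree is used instead.\<close>

definition hom_part :: "nat \<Rightarrow> 'a::comm_ring_1 mpoly \<Rightarrow> 'a mpoly" where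
  "hom_part d f = (\<Sum>t | t \<in> keys f \<and> mono_deg t = d. single t (lookup f t))"

lemma lookup_hom_part: "lookup (hom_part d f) t = (if mono_deg t = d then lookup f t else 0)"
  by (auto simp: hom_part_def lookup_sum_single in_keys_iff)

text \<open>Recentring substitutes linear forms for the variables, hence respects the grading. So
  each homogeneous part keeps the vanishing orders.\<close>

lemma mono_deg_recenter_single:
  assumes "u \<in> keys (recenter v (single t (1 :: 'a::comm_ring_1)))"
  shows "mono_deg u = mono_deg t"
proof -
  define hom where "hom n p \<longleftrightarrow> (\<forall>s\<in>keys p. mono_deg s = n)" for n and p :: "'a mpoly"
  have hom_add: "hom n p \<Longrightarrow> hom n q \<Longrightarrow> hom n (p + q)" for n p q
    using Poly_Mapping.keys_add[of p q] by (auto simp: hom_def)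
  have hom_mult: "hom n p \<Longrightarrow> hom m q \<Longrightarrow> hom (n + m) (p * q)" for n m p q
    using keys_mult[of p q] by (fastforce simp: hom_def mono_deg_eq_wdeg wdeg_add)
  have hom_1: "hom 0 1"
    by (simp add: hom_def mono_deg_eq_wdeg)
  have hom_power: "hom n p \<Longrightarrow> hom (n * k) (p ^ k)" for n p k
    by (induction k) (auto simp: hom_1 hom_mult)
  have hom_X: "hom 1 (X i)" and hom_Cst: "hom 0 (Cst c)" for i c
    by (auto simp: hom_def X_def Cst_def mono_deg_eq_wdeg)
  have "hom 1 (recenter_vars v i)" for i
    using hom_mult[OF hom_Cst hom_X] hom_X by (auto simp: recenter_vars_def intro!: hom_add)
  then have hv: "hom n (recenter_vars v i ^ n)" for i n
    using hom_power[of 1 _ n] by simp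
  have "finite A \<Longrightarrow> hom (\<Sum>i\<in>A. lookup t i) (\<Prod>i\<in>A. recenter_vars v i ^ lookup t i)" for A
    by (induction A rule: finite_induct) (auto simp: hom_1 intro: hom_mult hv)
  then have "hom (mono_deg t) (recenter v (single t 1))"
    by (simp add: recenter_def subst_single rhom_Cst rhom_1[OF rhom_Cst] monev_def mono_deg_def)
  with assms show ?thesis by (auto simp: hom_def)
qed

lemma recenter_hom_part: "recenter v (hom_part d f) = hom_part d (recenter v f)"
proof (rule poly_mapping_eqI)
  fix u
  have *: "mono_deg t = mono_deg u" if "lookup (recenter v (single t 1)) u \<noteq> (0::'a)" for t
    using that mono_deg_recenter_single[of u v t] by (auto simp: in_keys_iff)
  have "lookup (recenter v (hom_part d f)) u =
      (\<Sum>t\<in>{t\<in>keys f. mono_deg t = d}. lookup (recenter v (single t 1)) u * lookup f t)"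
    by (simp add: hom_part_def lookup_recenter_sum)
  also have "\<dots> = (if mono_deg u = d
      then \<Sum>t\<in>keys f. lookup (recenter v (single t 1)) u * lookup f t else 0)"
  proof (cases "mono_deg u = d")
    case True
    then show ?thesis
      unfolding if_P[OF True] using * by (intro sum.mono_neutral_left) (auto, metis mult_zero_left)
  next
    case False
    then show ?thesis using * by (auto intro!: sum.neutral) (metis mult_zero_left)
  qed
  also have "(\<Sum>t\<in>keys f. lookup (recenter v (single t 1)) u * lookup f t) = lookup (recenter v f) u"
    using lookup_recenter_sum[of v "lookup f" "keys f" u] by (simp add: mpoly_sum_single)
  finally show "lookup (recenter v (hom_part d f)) u = lookup (hom_part d (recenter v f)) u"
    by (simp add: lookup_hom_part)
qed

lemma fat_vanishing_hom_part: "fat_vanishing N a V f \<Longrightarrow> fat_vanishing N a V (hom_part d f)"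
  by (simp add: fat_vanishing_def recenter_hom_part yord_ge_iff lookup_hom_part)

lemma rhom_Fract: "rhom (\<lambda>p :: 'a::idom. Fract p 1)"
  by (rule rhomI) (auto simp: One_fract_def)

lemma generic_point_eq: "generic_point i j = Fract (X (prod_encode (i, j))) 1"
  by (simp add: generic_point_def X_def)

lemma ratfuns_lookup_Cst: "c \<in> ratfuns r N \<Longrightarrow> lookup (Cst c) t \<in> ratfuns r N"
  by (simp add: Cst_def lookup_single when_def)

lemma ratfuns_lookup_X: "lookup (X i) t \<in> ratfuns r N"
  by (simp add: X_def lookup_single when_def)

lemma ratfuns_lookup_prod:
  fixes f :: "'i \<Rightarrow> 'k::field ratfun mpoly"
  assumes "\<And>i t. i \<in> A \<Longrightarrow> lookup (f i) t \<in> ratfuns r N"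
  shows "lookup (\<Prod>i\<in>A. f i ^ n i) t \<in> ratfuns r N"
proof -
  have 1: "lookup (1 :: 'k ratfun mpoly) t \<in> ratfuns r N" for t
    by (simp add: lookup_one when_def)
  have p: "lookup (f i ^ k) t \<in> ratfuns r N" if "i \<in> A" for i k t
    using that by (induction k arbitrary: t) (auto simp: 1 intro!: ratfuns_lookup_mult assms)
  have "finite B \<Longrightarrow> B \<subseteq> A \<Longrightarrow> lookup (\<Prod>i\<in>B. f i ^ n i) t \<in> ratfuns r N" for B t
    by (induction B arbitrary: t rule: finite_induct) (auto simp: 1 intro!: ratfuns_lookup_mult p)
  then show ?thesis
    by (cases "finite A") (auto simp: 1)
qed

lemma ratfuns_lookup_recenter:
  assumes "i < r" "keys t \<subseteq> {..N}"
  shows "lookup (recenter (generic_point i) (single t 1)) u \<in> (ratfuns r N :: 'k::field ratfun set)"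
proof -
  have "lookup (recenter_vars (generic_point i) j) s \<in> (ratfuns r N :: 'k ratfun set)"
    if "j \<in> keys t" for j s
    using that assms
    by (auto simp: recenter_vars_def lookup_add
        intro!: ratfuns_mult ratfuns_add ratfuns_lookup_X generic_point_in_ratfuns)
  then show ?thesis
    by (simp add: recenter_def subst_single rhom_Cst rhom_1[OF rhom_Cst] monev_def ratfuns_lookup_prod)
qed

text \<open>The lists \<open>pre\<close> and \<open>post\<close> let one block collide while all
  other points stay generic; this makes the statement iterable.\<close>

lemma generic_collision:
  fixes f :: "'k::field ratfun mpoly"
  fixes pre post :: "nat list" and N m :: nat
  defines "a \<equiv> pre @ replicate (2 ^ N) m @ post" and "b \<equiv> pre @ [2 * m] @ post"
  assumes f: "f \<noteq> 0" "indets f \<subseteq> {..N}" "fat_vanishing N a generic_point f"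
  shows "\<exists>g :: 'k ratfun mpoly. g \<noteq> 0 \<and> keys g \<subseteq> {t. keys t \<subseteq> {..N} \<and> mono_deg t = total_deg f} \<and>
    (\<forall>t. lookup g t \<in> ratfuns (length b) N) \<and> fat_vanishing N b generic_point g"
proof -
  define d where "d = total_deg f"
  define J where "J = {t \<in> keys f. mono_deg t = d}"
  have J: "finite J" "\<And>t. t \<in> J \<Longrightarrow> keys t \<subseteq> {..N} \<and> mono_deg t = d"
    using f(2) by (auto simp: J_def indets_def)
  define \<iota> :: "'k mpoly \<Rightarrow> 'k ratfun" where "\<iota> = (\<lambda>p. Fract p 1)"
  have \<iota>: "rhom \<iota>" unfolding \<iota>_def by (rule rhom_Fract)
  have \<iota>0: "\<iota> p = 0 \<longleftrightarrow> p = 0" for p by (simp add: \<iota>_def Zero_fract_def eq_fract)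
  define z :: "nat \<Rightarrow> nat \<Rightarrow> 'k mpoly" where "z i j = X (prod_encode (i, j))" for i j
  have gp: "generic_point = (\<lambda>i. \<iota> \<circ> z i)"
    by (auto simp: fun_eq_iff generic_point_eq \<iota>_def z_def)
  let ?p = "length pre"
  obtain E :: "nat \<Rightarrow> nat set" where E: "bij_betw E {0..<2 ^ N} (Pow {1..N})"
    using ex_bij_betw_nat_finite[of "Pow {1..N}"] by (auto simp: card_Pow)
  \<comment> \<open>The block after \<open>pre\<close> moves along V + T Q, where V is the generic
    point numbered \<open>?p\<close> and \<open>E\<close> enumerates the subsets Q. The block leaves
    a single point, so the later indices drop by 2^N - 1.\<close>
  define W :: "nat \<Rightarrow> nat \<Rightarrow> 'k mpoly poly" where
    "W i j = (if i < ?p then [:z i j:]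
       else if i < ?p + 2 ^ N then [:z ?p j, of_bool (j \<in> E (i - ?p)):]
       else [:z (Suc i - 2 ^ N) j:])" for i j
  define \<psi> :: "'k mpoly \<Rightarrow> 'k mpoly poly" where
    "\<psi> = subst (\<lambda>c. [:Cst c:]) (\<lambda>n. W (fst (prod_decode n)) (snd (prod_decode n)))"
  have \<psi>: "rhom \<psi>" unfolding \<psi>_def by (intro rhom_subst rhom_const_poly rhom_Cst)
  have \<psi>z: "\<psi> \<circ> z i = W i" for i
    by (auto simp: fun_eq_iff \<psi>_def z_def subst_X rhom_const_poly rhom_Cst)

  have "hom_part d f \<noteq> 0" "keys (hom_part d f) \<subseteq> J"
  proof -
    have "d \<in> mono_deg ` keys f"
      unfolding d_def total_deg_def using f(1) by (intro Max_in) auto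
    then obtain t where "t \<in> keys f" "mono_deg t = d" by auto
    then have "lookup (hom_part d f) t \<noteq> 0" by (simp add: lookup_hom_part in_keys_iff)
    then show "hom_part d f \<noteq> 0" by auto
    show "keys (hom_part d f) \<subseteq> J"
      by (auto simp: J_def in_keys_iff lookup_hom_part split: if_splits)
  qed
  moreover have "fat_vanishing N a (\<lambda>i. \<iota> \<circ> z i) (hom_part d f)"
    using fat_vanishing_hom_part[OF f(3)] by (simp add: gp)
  \<comment> \<open>First transfer, along the embedding of k[z] in k(z) and the specialization
    \<open>\<psi>\<close> to k[z][T]; the coefficients are unrestricted here.\<close>
  ultimately have "\<exists>F. F \<noteq> 0 \<and> keys F \<subseteq> J \<and> (\<forall>t. lookup F t \<in> UNIV) \<and> fat_vanishing N a (\<lambda>i. \<psi> \<circ> z i) F"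
    by (intro fat_vanishing_transfer[OF \<iota> \<psi>]) (auto simp: \<iota>0 rhom_0[OF \<psi>] J)
  then obtain F where F: "F \<noteq> 0" "keys F \<subseteq> J" "fat_vanishing N a W F"
    by (auto simp: \<psi>z)
  obtain e H where H: "F = Cst (monom 1 e) * H" "cmap at_zero H \<noteq> 0"
    "\<And>u. lookup (cmap at_zero H) u = coeff (lookup F u) e"
    using factor_out_parameter[OF F(1)] by metis
  define F0 where "F0 = cmap at_zero H"
  have WH: "yord_ge N (a ! i) (recenter (W i) H)" if "i < length a" for i
    using F(3) that
    by (simp add: fat_vanishing_def H(1) rhom_mult[OF rhom_recenter] yord_ge_Cst_mult_iff)
  have WH0: "yord_ge N (a ! i) (recenter (z k) F0)" if "i < length a" "W i = (\<lambda>j. [:z k j:])" for i k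
    using yord_ge_cmap[OF rhom_poly WH[OF that(1)], of 0] that(2)
    by (simp add: cmap_recenter[OF rhom_poly] comp_def F0_def)
  have "yord_ge N (b ! k) (recenter (z k) F0)" if "k < length b" for k
  proof -
    consider "k < ?p" | "k = ?p" | "k > ?p" by linarith
    then show ?thesis
    proof cases
      case 1
      then show ?thesis
        using WH0[of k k] by (simp add: W_def a_def b_def nth_append fun_eq_iff)
    next
      case 2
      have "yord_ge N m (recenter (\<lambda>j. [:z ?p j, of_bool (j \<in> Q):]) H)" if "Q \<subseteq> {1..N}" for Q
      proof -
        have "Q \<in> E ` {0..<2 ^ N}"
          using bij_betw_imp_surj_on[OF E] that by simp
        then obtain l where l: "l < 2 ^ N" "E l = Q" by auto
        then have "W (?p + l) = (\<lambda>j. [:z ?p j, of_bool (j \<in> Q):])"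
          by (auto simp: W_def fun_eq_iff)
        moreover have "a ! (?p + l) = m" "?p + l < length a"
          using l by (auto simp: a_def nth_append)
        ultimately show ?thesis using WH by metis
      qed
      then show ?thesis
        using collision[of N m "z ?p" H] 2 by (simp add: F0_def b_def nth_append)
    next
      case 3
      define l where "l = k - Suc ?p"
      have k: "k = Suc (?p + l)" using 3 by (simp add: l_def)
      have "a ! (?p + 2 ^ N + l) = b ! k" "?p + 2 ^ N + l < length a"
        using that by (auto simp: a_def b_def k nth_append)
      moreover have "W (?p + 2 ^ N + l) = (\<lambda>j. [:z k j:])"
        by (auto simp: W_def k fun_eq_iff)
      ultimately show ?thesis using WH0 by metis
    qed
  qed
  then have F0: "fat_vanishing N b z F0" by (simp add: fat_vanishing_def)
  have "keys F0 \<subseteq> J"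
    using F(2) H(3) by (fastforce simp: F0_def in_keys_iff)
  \<comment> \<open>Second transfer, along the identity of k[z] and its embedding in k(z). Solving
    again inside \<open>ratfuns\<close> removes indeterminates that do not belong to the remaining
    points.\<close>
  then have "\<exists>g. g \<noteq> 0 \<and> keys g \<subseteq> J \<and> (\<forall>t. lookup g t \<in> ratfuns (length b) N) \<and>
      fat_vanishing N b (\<lambda>i. \<iota> \<circ> z i) g"
  proof (intro fat_vanishing_transfer[where f = "\<lambda>x. x" and p = F0])
    show "lookup (recenter (\<iota> \<circ> z i) (single t 1)) u \<in> ratfuns (length b) N"
      if "t \<in> J" "i < length b" for t i u
      using ratfuns_lookup_recenter[OF that(2), of t N u] J(2)[OF that(1)] gp by metis
    show "F0 \<noteq> 0" using H(2) by (simp add: F0_def)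
    show "fat_vanishing N b (\<lambda>i. (\<lambda>x. x) \<circ> z i) F0" using F0 by (simp add: comp_def)
  qed (auto simp: \<iota>0 rhom_id \<iota> J(1))
  then show ?thesis using J(2) unfolding gp d_def by blast
qed

section \<open>Powers of the ideal of a generic point\<close>

lemma coord_ring_simps [simp]:
  "x \<otimes>\<^bsub>coord_ring r N\<^esub> y = x * y" "x \<oplus>\<^bsub>coord_ring r N\<^esub> y = x + y"
  "\<one>\<^bsub>coord_ring r N\<^esub> = 1" "\<zero>\<^bsub>coord_ring r N\<^esub> = 0"
  by (simp_all add: coord_ring_def)

lemma coord_ring_carrier:
  "f \<in> carrier (coord_ring r N) \<longleftrightarrow> indets f \<subseteq> {..N} \<and> (\<forall>t. lookup f t \<in> ratfuns r N)"
  by (simp add: coord_ring_def)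

lemma ideals_set_simps [simp]:
  "carrier (ideals_set R) = {I. ideal I R}" "x \<otimes>\<^bsub>ideals_set R\<^esub> y = x \<cdot>\<^bsub>R\<^esub> y"
  "\<one>\<^bsub>ideals_set R\<^esub> = carrier R"
  by (simp_all add: ideals_set_def)

text \<open>A two-by-two minor of the coordinates of the point and the variables. Recentring at the
  point turns it, for j > 0, into \<open>X j\<close> times the nonzero constant z_i0.\<close>

definition line_form :: "nat \<Rightarrow> nat \<Rightarrow> 'k::field ratfun mpoly" where
  "line_form i j = Cst (generic_point i 0) * X j - Cst (generic_point i j) * X 0"

lemma line_form_eq:
  "line_form i j = single (single j 1) (generic_point i 0) - single (single 0 1) (generic_point i j)"
  by (simp add: line_form_def Cst_def X_def mult_single)

context
  fixes r N :: nat and R :: "'k::field ratfun mpoly ring"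
  assumes R_def: "R = coord_ring r N"
begin

interpretation R: cring R
  unfolding R_def by (rule cring_coord_ring)

interpretation M: Group.comm_monoid "ideals_set R"
  by (rule R.ideals_set_is_comm_monoid)

private lemma R_simps [simp]: "x \<otimes>\<^bsub>R\<^esub> y = x * y" "x \<oplus>\<^bsub>R\<^esub> y = x + y" "\<one>\<^bsub>R\<^esub> = 1" "\<zero>\<^bsub>R\<^esub> = 0"
  by (simp_all add: R_def)

lemma carrier_add: "f \<in> carrier R \<Longrightarrow> g \<in> carrier R \<Longrightarrow> f + g \<in> carrier R"
  and carrier_mult: "f \<in> carrier R \<Longrightarrow> g \<in> carrier R \<Longrightarrow> f * g \<in> carrier R"
  and carrier_1: "1 \<in> carrier R" and carrier_0: "0 \<in> carrier R"
  using R.a_closed[of f g] R.m_closed[of f g] R.one_closed R.zero_closed by simp_all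

lemma carrier_uminus: "f \<in> carrier R \<Longrightarrow> - f \<in> carrier R"
  by (auto simp: R_def coord_ring_carrier)

lemma carrier_sum: "(\<And>x. x \<in> A \<Longrightarrow> f x \<in> carrier R) \<Longrightarrow> sum f A \<in> carrier R"
  by (induction A rule: infinite_finite_induct) (auto simp: carrier_0 carrier_add)

lemma carrier_power: "f \<in> carrier R \<Longrightarrow> f ^ n \<in> carrier R"
  by (induction n) (auto simp: carrier_1 carrier_mult)

lemma carrier_prod: "(\<And>x. x \<in> A \<Longrightarrow> f x \<in> carrier R) \<Longrightarrow> prod f A \<in> carrier R"
  by (induction A rule: infinite_finite_induct) (auto simp: carrier_1 carrier_mult)

lemma carrier_Cst: "c \<in> ratfuns r N \<Longrightarrow> Cst c \<in> carrier R"
  by (auto simp: R_def coord_ring_carrier ratfuns_lookup_Cst) (auto simp: indets_def Cst_def split: if_splits)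

lemma carrier_X: "i \<le> N \<Longrightarrow> X i \<in> carrier R"
  by (auto simp: R_def coord_ring_carrier ratfuns_lookup_X) (auto simp: indets_def X_def)

lemma carrier_subst:
  assumes "f \<in> carrier R" "\<And>i. i \<le> N \<Longrightarrow> b i \<in> carrier R"
  shows "subst Cst b f \<in> carrier R"
  unfolding subst_def monev_def using assms
  by (intro carrier_sum carrier_mult carrier_prod carrier_power carrier_Cst)
    (auto simp: R_def coord_ring_carrier indets_def)

lemma ideal_sum:
  assumes "ideal I R" "\<And>x. x \<in> A \<Longrightarrow> f x \<in> I" shows "sum f A \<in> I"
proof -
  have "0 \<in> I" "\<And>x y. x \<in> I \<Longrightarrow> y \<in> I \<Longrightarrow> x + y \<in> I"
    using additive_subgroup.zero_closed[OF ideal.axioms(1)[OF assms(1)]]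
      additive_subgroup.a_closed[OF ideal.axioms(1)[OF assms(1)]] by simp_all
  then show ?thesis
    using assms(2) by (induction A rule: infinite_finite_induct) auto
qed

lemma ideal_mult_left: "ideal I R \<Longrightarrow> f \<in> I \<Longrightarrow> g \<in> carrier R \<Longrightarrow> g * f \<in> I"
  using ideal.I_l_closed[of I R f g] by simp

context
  fixes i :: nat
  assumes i: "i < r"
begin

private abbreviation v :: "nat \<Rightarrow> 'k ratfun" where "v \<equiv> generic_point i"
private abbreviation \<pp> :: "'k ratfun mpoly set" where "\<pp> \<equiv> point_ideal r N v"
private abbreviation pw :: "nat \<Rightarrow> 'k ratfun mpoly set" where "pw n \<equiv> \<pp> [^]\<^bsub>ideals_set R\<^esub> n"

lemma generic_point_nonzero: "(generic_point i j :: 'k ratfun) \<noteq> 0"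
proof -
  have "X n \<noteq> (0 :: 'k mpoly)" for n
    by (metis X_def keys_single keys_zero one_neq_zero insert_not_empty)
  then show ?thesis by (simp add: generic_point_eq Zero_fract_def eq_fract)
qed

lemma ideal_point_ideal: "ideal \<pp> R"
  unfolding point_ideal_def R_def[symmetric] by (rule R.genideal_ideal) auto

lemma ideal_point_power: "ideal (pw n) R"
  using M.nat_pow_closed[of \<pp> n] ideal_point_ideal by simp

lemma point_power_mult:
  assumes "f \<in> pw m" "g \<in> pw n"
  shows "f * g \<in> pw (m + n)"
proof -
  have "f * g \<in> (pw m) \<cdot>\<^bsub>R\<^esub> (pw n)"
    using ideal_prod.prod[OF assms, of R] by simp
  then show ?thesis
    using M.nat_pow_mult[of \<pp> m n] ideal_point_ideal by simp
qed

lemma point_power_antimono: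
  assumes "m \<le> n" shows "pw n \<subseteq> pw m"
  using assms
proof (induction n rule: dec_induct)
  case (step n)
  have "pw (Suc n) = (pw n) \<cdot>\<^bsub>R\<^esub> \<pp>"
    by (simp add: M.nat_pow_Suc)
  then show ?case
    using step.IH R.ideal_prod_inter[OF ideal_point_power[of n] ideal_point_ideal] by auto
qed simp

text \<open>Setting the affine coordinates to 0 after recentring leaves the value of
  \<open>f\<close> at the point times a power of \<open>X 0\<close>.\<close>

lemma yord_ge_1_recenter:
  assumes "homogeneous f" "indets f \<subseteq> {..N}" "eval_mpoly v f = 0"
  shows "yord_ge N 1 (recenter v f)"
proof -
  obtain d where d: "\<And>t. t \<in> keys f \<Longrightarrow> mono_deg t = d"
    using assms(1) by (auto simp: homogeneous_def)
  \<comment> \<open>\<open>scale N 0\<close> annihilates only the variables 1 to N, so those above N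
    survive in \<open>b\<close>; they do not occur in \<open>f\<close>.\<close>
  define b :: "nat \<Rightarrow> 'k ratfun mpoly" where
    "b j = (if j \<le> N then Cst (v j) * X 0 else X j + Cst (v j) * X 0)" for j
  have sX: "scale N c (X i) = Cst (c ^ grid_weight {1..N} i) * X i" for i and c :: "'k ratfun"
    by (simp add: scale_def subst_X rhom_Cst)
  have sC: "scale N c (Cst e) = Cst e" for e c :: "'k ratfun"
    by (simp add: scale_def subst_Cst rhom_Cst)
  have "(scale N 0 \<circ> recenter v) f = subst Cst b f"
    by (rule rhom_mpoly_eqI[where f = "scale N 0 \<circ> recenter v" and g = "subst Cst b"])
      (auto simp: rhom_comp rhom_scale rhom_recenter rhom_subst rhom_Cst subst_Cst subst_X sX sC
        recenter_X rhom_add[OF rhom_scale] rhom_mult[OF rhom_scale] b_def grid_weight_def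
        rhom_0[OF rhom_Cst] rhom_1[OF rhom_Cst])
  also have "\<dots> = subst Cst (\<lambda>j. Cst (v j) * X 0) f"
    using assms(2) by (intro subst_cong) (auto simp: b_def)
  also have "\<dots> = (\<Sum>t\<in>keys f. Cst (lookup f t * monev v t) * X 0 ^ d)"
    unfolding subst_def
  proof (rule sum.cong)
    fix t assume "t \<in> keys f"
    have "monev (\<lambda>_. X 0 :: 'k ratfun mpoly) t = X 0 ^ d"
      using d[OF \<open>t \<in> keys f\<close>] monev_power[of "X 0 :: 'k ratfun mpoly" "\<lambda>_. 1" t]
      by (simp add: mono_deg_eq_wdeg)
    moreover have "monev (\<lambda>j. Cst (v j)) t = Cst (monev v t)"
      using monev_rhom[OF rhom_Cst, of v t] by (simp add: comp_def)
    ultimately show "Cst (lookup f t) * monev (\<lambda>j. Cst (v j) * X 0) t =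
        Cst (lookup f t * monev v t) * X 0 ^ d"
      by (simp add: monev_mult rhom_mult[OF rhom_Cst] mult.assoc)
  qed simp
  also have "\<dots> = Cst (eval_mpoly v f) * X 0 ^ d"
    by (simp add: eval_mpoly_eq_subst subst_def rhom_sum[OF rhom_Cst] sum_distrib_right)
  finally have "scale N 0 (recenter v f) = 0"
    using assms(3) by (simp add: rhom_0[OF rhom_Cst])
  then have "0 ^ ydeg N t * lookup (recenter v f) t = 0" for t
    using lookup_scale[of N 0 "recenter v f" t] by simp
  then have "lookup (recenter v f) t = 0" if "ydeg N t < 1" for t
    using that by (metis less_one mult_1 power_0)
  then show ?thesis by (simp only: yord_ge_iff) blast
qed

lemma point_ideal_yord_ge:
  assumes "f \<in> \<pp>" shows "yord_ge N 1 (recenter v f)"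
proof -
  define K where "K = {f \<in> carrier R. yord_ge N 1 (recenter v f)}"
  note rc = rhom_recenter[where ?'a = "'k ratfun" and v = v]
  have "ideal K R"
  proof (rule idealI)
    show "ring R" by (rule R.ring_axioms)
    show "subgroup K (add_monoid R)"
    proof
      fix x assume x: "x \<in> K"
      then have "- x \<in> K"
        by (auto simp: K_def carrier_uminus rhom_minus[OF rc] yord_ge_iff)
      moreover have "\<ominus>\<^bsub>R\<^esub> x = - x"
        using x by (intro R.minus_equality) (auto simp: K_def carrier_uminus)
      ultimately show "inv\<^bsub>add_monoid R\<^esub> x \<in> K" by (simp add: a_inv_def)
    qed (auto simp: K_def carrier_0 carrier_add rhom_0[OF rc] rhom_add[OF rc] yord_ge_add yord_ge_iff lookup_add)
  next
    fix a x assume "a \<in> K" "x \<in> carrier R"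
    then show "x \<otimes>\<^bsub>R\<^esub> a \<in> K" "a \<otimes>\<^bsub>R\<^esub> x \<in> K"
      using yord_ge_mult[OF yord_ge_0[of N "recenter v x"], of 1 "recenter v a"]
      by (auto simp: K_def carrier_mult rhom_mult[OF rc] mult.commute)
  qed
  then have "\<pp> \<subseteq> K"
    unfolding point_ideal_def R_def[symmetric]
    using yord_ge_1_recenter
    by (intro R.genideal_minimal) (auto simp: K_def R_def coord_ring_carrier simp del: One_nat_def)
  then show ?thesis using assms by (auto simp: K_def)
qed

lemma point_power_yord_ge:
  assumes "f \<in> pw n" shows "yord_ge N n (recenter v f)"
  using assms
proof (induction n arbitrary: f)
  case 0
  then show ?case by (simp add: yord_ge_0)
next
  case (Suc n)
  have "f \<in> (pw n) \<cdot>\<^bsub>R\<^esub> \<pp>"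
    using Suc.prems by (simp add: M.nat_pow_Suc)
  then show ?case
  proof (induction f rule: ideal_prod.induct)
    case (prod g h)
    then show ?case
      using yord_ge_mult[OF Suc.IH[OF prod(1)] point_ideal_yord_ge[OF prod(2)]]
      by (simp add: rhom_mult[OF rhom_recenter])
  next
    case (sum g h)
    then show ?case by (simp add: rhom_add[OF rhom_recenter] yord_ge_add)
  qed
qed

lemma line_form_carrier: "j \<le> N \<Longrightarrow> line_form i j \<in> carrier R"
  using carrier_add[OF _ carrier_uminus, of "Cst (v 0) * X j" "Cst (v j) * X 0"] i
  by (simp add: line_form_def carrier_mult carrier_Cst carrier_X generic_point_in_ratfuns)

lemma line_form_point_ideal:
  assumes "j \<le> N" shows "line_form i j \<in> \<pp>"
proof -
  have "keys (line_form i j :: 'k ratfun mpoly) \<subseteq> {single j 1, single 0 1}"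
    unfolding line_form_eq by (rule order.trans[OF keys_diff]) auto
  then have "homogeneous (line_form i j :: 'k ratfun mpoly)"
    by (auto simp: homogeneous_def mono_deg_eq_wdeg intro!: exI[of _ 1])
  moreover have "eval_mpoly v (line_form i j) = 0"
    by (simp add: eval_mpoly_eq_subst line_form_def rhom_diff[OF rhom_subst[OF rhom_id(2)]]
        rhom_mult[OF rhom_subst[OF rhom_id(2)]] subst_Cst[OF rhom_id(2)] subst_X[OF rhom_id(2)])
  ultimately show ?thesis
    unfolding point_ideal_def R_def[symmetric]
    using line_form_carrier[OF assms] by (intro subsetD[OF R.genideal_self]) auto
qed

lemma line_form_nonzero: "line_form i 1 \<noteq> (0 :: 'k ratfun mpoly)"
proof -
  have "single 0 1 \<noteq> (single 1 1 :: nat \<Rightarrow>\<^sub>0 nat)"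
    by (metis lookup_single_eq lookup_single_not_eq zero_neq_one)
  then have "lookup (line_form i 1 :: 'k ratfun mpoly) (single 1 1) = v 0"
    by (simp add: line_form_eq lookup_minus lookup_single when_def)
  then show ?thesis using generic_point_nonzero by (metis lookup_zero)
qed

lemma point_power_power: "f \<in> \<pp> \<Longrightarrow> f ^ n \<in> pw n"
proof (induction n)
  case (Suc n)
  have "f \<in> pw (1 :: nat)"
    using Suc.prems ideal_point_ideal M.nat_pow_Suc[of \<pp> 0] M.l_one[of \<pp>] by simp
  then show ?case using point_power_mult[of f 1 "f ^ n" n] Suc by simp
qed (simp add: carrier_1)

lemma point_power_prod:
  assumes "finite A" "A \<subseteq> {1..N}"
  shows "(\<Prod>j\<in>A. line_form i j ^ u j) \<in> pw (\<Sum>j\<in>A. u j)"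
  using assms
  by (induction A rule: finite_induct)
    (auto simp: carrier_1 intro!: point_power_mult point_power_power line_form_point_ideal)

text \<open>Substituting line forms for the affine coordinates undoes recentring up to multiplying
  every variable by z_i0. Thus z_i0^d \<open>f\<close> is a combination of products of at least
  \<open>n\<close> line forms, each of which lies in the point ideal.\<close>

lemma point_power_memI:
  assumes f: "f \<in> carrier R" "\<And>t. t \<in> keys f \<Longrightarrow> mono_deg t = d" and n: "yord_ge N n (recenter v f)"
  shows "f \<in> pw n"
proof -
  let ?I = "pw n"
  define b :: "nat \<Rightarrow> 'k ratfun mpoly" where "b j = (if j = 0 then X 0 else line_form i j)" for j
  define g where "g = recenter v f"
  have gR: "g \<in> carrier R"
    unfolding g_def recenter_def using f(1) i
    by (intro carrier_subst)
      (auto simp: recenter_vars_def generic_point_in_ratfuns intro!: carrier_mult carrier_add carrier_Cst carrier_X)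
  have "(subst Cst b \<circ> recenter v) f = subst Cst (\<lambda>j. Cst (v 0) * X j) f"
    by (rule rhom_mpoly_eqI[where f = "subst Cst b \<circ> recenter v" and g = "subst Cst (\<lambda>j. Cst (v 0) * X j)"])
      (auto simp: rhom_comp rhom_recenter rhom_subst rhom_Cst subst_Cst subst_X recenter_X
        rhom_add[OF rhom_subst[OF rhom_Cst]] rhom_mult[OF rhom_subst[OF rhom_Cst]] b_def line_form_def)
  also have "\<dots> = (\<Sum>t\<in>keys f. Cst (v 0 ^ d) * single t (lookup f t))"
    unfolding subst_def
  proof (rule sum.cong)
    fix t assume t: "t \<in> keys f"
    have "monev (\<lambda>_. Cst (v 0)) t = Cst (v 0 ^ d)"
      using f(2)[OF t] monev_power[of "Cst (v 0)" "\<lambda>_. 1" t]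
      by (simp add: mono_deg_eq_wdeg rhom_power[OF rhom_Cst])
    then show "Cst (lookup f t) * monev (\<lambda>j. Cst (v 0) * X j) t = Cst (v 0 ^ d) * single t (lookup f t)"
      by (simp add: monev_mult single_eq[of t "lookup f t"] mult_ac)
  qed simp
  also have "\<dots> = Cst (v 0 ^ d) * f"
    by (simp add: sum_distrib_left[symmetric] mpoly_sum_single)
  finally have eq: "subst Cst b g = Cst (v 0 ^ d) * f" by (simp add: g_def)
  have "Cst (lookup g u) * monev b u \<in> ?I" if u: "u \<in> keys g" for u
  proof -
    have uN: "keys u \<subseteq> {..N}" using gR u by (auto simp: R_def coord_ring_carrier indets_def)
    have un: "n \<le> ydeg N u" using n u by (auto simp: yord_ge_def g_def)
    have yd: "ydeg N u = (\<Sum>j\<in>{1..N}. lookup u j)"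
      unfolding ydeg_def using uN
      by (subst wdeg_superset[of "{..N}"])
        (auto simp: grid_weight_def intro!: sum.mono_neutral_cong_right)
    have "monev b u = (\<Prod>j\<in>{..N}. b j ^ lookup u j)"
      using uN by (intro monev_superset) auto
    also have "{..N} = insert 0 {1..N}" by auto
    also have "(\<Prod>j\<in>insert 0 {1..N}. b j ^ lookup u j) =
        X 0 ^ lookup u 0 * (\<Prod>j\<in>{1..N}. line_form i j ^ lookup u j)"
      by (subst prod.insert) (auto simp: b_def intro!: prod.cong)
    finally have "Cst (lookup g u) * monev b u =
        (Cst (lookup g u) * X 0 ^ lookup u 0) * (\<Prod>j\<in>{1..N}. line_form i j ^ lookup u j)"
      by (simp add: mult.assoc)
    moreover have "(\<Prod>j\<in>{1..N}. line_form i j ^ lookup u j) \<in> ?I"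
      using point_power_prod[of "{1..N}" "lookup u"] point_power_antimono[OF un] yd by auto
    moreover have "Cst (lookup g u) * X 0 ^ lookup u 0 \<in> carrier R"
      using gR by (intro carrier_mult carrier_power carrier_Cst carrier_X)
        (auto simp: R_def coord_ring_carrier)
    ultimately show ?thesis by (simp only: ideal_mult_left[OF ideal_point_power])
  qed
  then have "subst Cst b g \<in> ?I"
    unfolding subst_def by (rule ideal_sum[OF ideal_point_power])
  \<comment> \<open>The factor z_i0^d is inverted inside \<open>ratfuns r N\<close>, so the division
    stays in the coordinate ring.\<close>
  moreover have vd: "inverse (v 0 ^ d) \<in> ratfuns r N"
  proof -
    have "v 0 ^ k \<in> ratfuns r N" for k
      using i by (induction k) (auto simp: generic_point_in_ratfuns)
    then show ?thesis by auto
  qed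
  ultimately have "Cst (inverse (v 0 ^ d)) * (Cst (v 0 ^ d) * f) \<in> ?I"
    by (simp only: eq[symmetric] ideal_mult_left[OF ideal_point_power] carrier_Cst)
  moreover have "Cst (inverse (v 0 ^ d)) * (Cst (v 0 ^ d) * f) = f"
    using generic_point_nonzero[of 0]
    by (simp add: mult.assoc[symmetric] rhom_mult[OF rhom_Cst, symmetric] rhom_1[OF rhom_Cst])
  ultimately show ?thesis by simp
qed

end
end

section \<open>Initial degrees and Waldschmidt constants\<close>

lemma fat_ideal_iff:
  "f \<in> fat_ideal N a \<longleftrightarrow> f \<in> carrier (coord_ring (length a) N :: 'k::field ratfun mpoly ring) \<and>
    (\<forall>i<length a. f \<in> point_ideal (length a) N (generic_point i)
       [^]\<^bsub>ideals_set (coord_ring (length a) N)\<^esub> (a ! i))"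
  by (auto simp: fat_ideal_def Let_def)

lemma fat_ideal_fat_vanishing:
  "f \<in> fat_ideal N a \<Longrightarrow> fat_vanishing N a generic_point (f :: 'k::field ratfun mpoly)"
  unfolding fat_ideal_iff fat_vanishing_def by (blast intro: point_power_yord_ge[OF refl])

lemma fat_ideal_memI:
  fixes f :: "'k::field ratfun mpoly"
  assumes "keys f \<subseteq> {t. keys t \<subseteq> {..N} \<and> mono_deg t = d}" "\<forall>t. lookup f t \<in> ratfuns (length a) N"
    and "fat_vanishing N a generic_point f"
  shows "f \<in> fat_ideal N a"
proof -
  have "f \<in> carrier (coord_ring (length a) N)"
    using assms(1,2) by (auto simp: coord_ring_carrier indets_def)
  moreover have "mono_deg t = d" if "t \<in> keys f" for t using assms(1) that by auto
  ultimately have "f \<in> point_ideal (length a) N (generic_point i)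
      [^]\<^bsub>ideals_set (coord_ring (length a) N)\<^esub> (a ! i)" if "i < length a" for i
    using assms(3) that by (intro point_power_memI[OF refl, of i _ _ _ d]) (auto simp: fat_vanishing_def)
  with \<open>f \<in> carrier _\<close> show ?thesis by (simp add: fat_ideal_iff)
qed

lemma symbolic_power_mult:
  fixes f g :: "'k::field ratfun mpoly"
  assumes "f \<in> symbolic_power N a m" "g \<in> symbolic_power N a n"
  shows "f * g \<in> symbolic_power N a (m + n)"
proof -
  let ?I = "\<lambda>i n. point_ideal (length a) N (generic_point i)
    [^]\<^bsub>ideals_set (coord_ring (length a) N)\<^esub> (n :: nat) :: 'k ratfun mpoly set"
  have "f * g \<in> ?I i (m * a ! i + n * a ! i)" if "i < length a" for i
    using assms that by (intro point_power_mult[OF refl]) (auto simp: symbolic_power_def fat_ideal_iff)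
  then show ?thesis
    using assms carrier_mult[OF refl, of f "length a" N g]
    by (auto simp: symbolic_power_def fat_ideal_iff distrib_right)
qed

text \<open>Makes \<open>initial_degree\<close> meaningful. The witness takes, for each point, a
  line form raised to the required multiplicity.\<close>

lemma fat_ideal_nonzero:
  assumes "N \<ge> 1"
  shows "\<exists>f \<in> fat_ideal N a. f \<noteq> (0 :: 'k::field ratfun mpoly)"
proof
  define r where "r = length a"
  let ?f = "\<lambda>A. \<Prod>i\<in>A. line_form i 1 ^ (a ! i) :: 'k ratfun mpoly"
  note car = carrier_prod[OF refl] carrier_power[OF refl] line_form_carrier[OF refl]
  show "?f {..<r} \<noteq> 0" by (simp add: line_form_nonzero[simplified])
  show "?f {..<r} \<in> fat_ideal N a"
    unfolding fat_ideal_iff r_def[symmetric]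
  proof (intro conjI allI impI)
    show "?f {..<r} \<in> carrier (coord_ring r N)" using assms by (intro car) auto
    fix i assume i: "i < r"
    then have "?f {..<r} = ?f ({..<r} - {i}) * line_form i 1 ^ (a ! i)"
      by (subst prod.remove[of _ i]) (auto simp: mult.commute)
    moreover have "line_form i 1 ^ (a ! i) \<in> point_ideal r N (generic_point i)
        [^]\<^bsub>ideals_set (coord_ring r N)\<^esub> (a ! i)"
      using i assms by (intro point_power_power[OF refl] line_form_point_ideal[OF refl])
    moreover have "?f ({..<r} - {i}) \<in> carrier (coord_ring r N)"
      using assms by (intro car) auto
    ultimately show "?f {..<r} \<in> point_ideal r N (generic_point i)
        [^]\<^bsub>ideals_set (coord_ring r N)\<^esub> (a ! i)"
      using ideal_mult_left[OF refl ideal_point_power[OF refl i]] by simp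
  qed
qed

lemma initial_degree_attained:
  assumes "f \<in> J" "f \<noteq> 0"
  obtains p where "p \<in> J" "p \<noteq> 0" "total_deg p = initial_degree J"
proof -
  have "\<exists>d. \<exists>p\<in>J. p \<noteq> 0 \<and> total_deg p = d" using assms by auto
  from LeastI_ex[OF this] show ?thesis using that unfolding initial_degree_def by auto
qed

lemma initial_degree_le: "p \<in> J \<Longrightarrow> p \<noteq> 0 \<Longrightarrow> initial_degree J \<le> total_deg p"
  unfolding initial_degree_def by (rule Least_le) auto

lemma total_deg_mult_le:
  fixes p q :: "'a::idom mpoly"
  assumes "p \<noteq> 0" "q \<noteq> 0" shows "total_deg (p * q) \<le> total_deg p + total_deg q"
proof -
  have "mono_deg t \<le> total_deg p + total_deg q" if t: "t \<in> keys (p * q)" for t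
  proof -
    obtain u w where "u \<in> keys p" "w \<in> keys q" "t = u + w"
      using keys_mult[of p q] t by blast
    then show ?thesis
      by (auto simp: mono_deg_eq_wdeg wdeg_add total_deg_def intro!: add_mono Max_ge)
  qed
  moreover have "keys (p * q) \<noteq> {}" using assms by simp
  ultimately show ?thesis unfolding total_deg_def[of "p * q"] by (intro Max.boundedI) auto
qed

section \<open>Subadditivity and the passage to the limit\<close>

lemma initial_degree_symbolic_subadditive:
  assumes "N \<ge> 1"
  shows "initial_degree (symbolic_power N a (m + n) :: 'k::field ratfun mpoly set)
    \<le> initial_degree (symbolic_power N a m :: 'k ratfun mpoly set)
      + initial_degree (symbolic_power N a n :: 'k ratfun mpoly set)"
proof -
  have ex: "\<exists>p\<in>(symbolic_power N a k :: 'k ratfun mpoly set). p \<noteq> 0 \<and>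
      total_deg p = initial_degree (symbolic_power N a k :: 'k ratfun mpoly set)" for k
  proof -
    obtain f where "f \<in> symbolic_power N a k" "f \<noteq> (0 :: 'k ratfun mpoly)"
      using fat_ideal_nonzero[OF assms] unfolding symbolic_power_def by blast
    then obtain p :: "'k ratfun mpoly" where "p \<in> symbolic_power N a k" "p \<noteq> 0"
      "total_deg p = initial_degree (symbolic_power N a k :: 'k ratfun mpoly set)"
      by (rule initial_degree_attained)
    then show ?thesis by blast
  qed
  obtain p q :: "'k ratfun mpoly" where p: "p \<in> symbolic_power N a m" "p \<noteq> 0"
      "total_deg p = initial_degree (symbolic_power N a m :: 'k ratfun mpoly set)"
    and q: "q \<in> symbolic_power N a n" "q \<noteq> 0"
      "total_deg q = initial_degree (symbolic_power N a n :: 'k ratfun mpoly set)"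
    using ex[of m] ex[of n] by blast
  have "initial_degree (symbolic_power N a (m + n) :: 'k ratfun mpoly set) \<le> total_deg (p * q)"
    using p q by (intro initial_degree_le symbolic_power_mult) auto
  also have "\<dots> \<le> total_deg p + total_deg q" using p q by (intro total_deg_mult_le)
  finally show ?thesis using p q by simp
qed

text \<open>Fekete's argument, with the infimum over n >= 1 as limit. It is needed because
  \<open>waldschmidt\<close> is a \<open>lim\<close>, and limits can be compared only once they
  exist.\<close>

lemma convergent_subadditive_quotient:
  fixes u :: "nat \<Rightarrow> nat"
  assumes sub: "\<And>m n. u (m + n) \<le> u m + u n"
  shows "convergent (\<lambda>n. real (u n) / real n)"
proof -
  define L where "L = (INF n\<in>{1..}. real (u n) / real n)"
  have bdd: "bdd_below ((\<lambda>n. real (u n) / real n) ` {1..})"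
    by (intro bdd_belowI[of _ 0]) auto
  have L_le: "L \<le> real (u n) / real n" if "n \<ge> 1" for n
    unfolding L_def using that bdd by (intro cINF_lower) auto
  have mult: "u (q * k + s) \<le> q * u k + u s" for q k s
  proof (induction q)
    case (Suc q)
    then show ?case using sub[of k "q * k + s"] by (simp add: add.assoc)
  qed simp
  have "(\<lambda>n. real (u n) / real n) \<longlonglongrightarrow> L"
  proof (rule LIMSEQ_I)
    fix e :: real assume e: "e > 0"
    have "\<exists>k\<in>{1..}. real (u k) / real k < L + e / 2"
      using e cINF_less_iff[OF _ bdd, of "L + e / 2"] by (auto simp: L_def)
    then obtain k where k: "k \<ge> 1" "real (u k) / real k < L + e / 2" by auto
    \<comment> \<open>Bounds u at the remainder of n modulo k, independently of n, so its share B /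
      n is below e / 2 for large n.\<close>
    define B where "B = Max (u ` {..<k})"
    obtain n0 where n0: "real B / (e / 2) < real n0" using reals_Archimedean2 by blast
    have "norm (real (u n) / real n - L) < e" if n: "n \<ge> max 1 n0" for n
    proof -
      have n1: "real n > 0" and nn: "real n0 \<le> real n" using n by auto
      have "u n \<le> (n div k) * u k + u (n mod k)"
        using mult[of "n div k" k "n mod k"] by simp
      also have "u (n mod k) \<le> B"
        unfolding B_def using k by (intro Max_ge) auto
      finally have "real (u n) \<le> real (n div k) * real (u k) + real B"
        by (metis (mono_tags) add_left_mono of_nat_add of_nat_le_iff of_nat_mult)
      also have "real (n div k) * real (u k) \<le> (real n / real k) * real (u k)"
        by (intro mult_right_mono of_nat_div_le_of_nat) auto
      finally have "real (u n) / real n \<le> ((real n / real k) * real (u k) + real B) / real n"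
        using n1 by (intro divide_right_mono) auto
      also have "\<dots> = real (u k) / real k + real B / real n"
        using n1 by (simp add: add_divide_distrib)
      also have "real B / real n < e / 2"
      proof -
        have "real B < (e / 2) * real n0" using n0 e by (simp add: field_simps)
        also have "\<dots> \<le> (e / 2) * real n" using nn e by (intro mult_left_mono) auto
        finally show ?thesis using n1 by (simp add: field_simps)
      qed
      finally have "real (u n) / real n < L + e" using k(2) by linarith
      moreover have "L \<le> real (u n) / real n" using n by (intro L_le) auto
      ultimately show ?thesis by (simp add: abs_if)
    qed
    then show "\<exists>no. \<forall>n\<ge>no. norm (real (u n) / real n - L) < e" by blast
  qed
  then show ?thesis by (rule convergentI)
qed

lemma initial_degree_collision:
  assumes "N \<ge> 1"
  shows "initial_degree (symbolic_power N (pre @ [2] @ post) m :: 'k::field ratfun mpoly set)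
    \<le> initial_degree (symbolic_power N (pre @ replicate (2 ^ N) 1 @ post) m :: 'k ratfun mpoly set)"
    (is "_ \<le> initial_degree ?J")
proof -
  let ?pre = "map (\<lambda>c. m * c) pre" and ?post = "map (\<lambda>c. m * c) post"
  have J: "?J = fat_ideal N (?pre @ replicate (2 ^ N) m @ ?post)"
    by (simp add: symbolic_power_def map_replicate)
  obtain f0 where "f0 \<in> ?J" "f0 \<noteq> 0"
    using fat_ideal_nonzero[OF assms] unfolding J by blast
  then obtain f where f: "f \<in> ?J" "f \<noteq> 0" "total_deg f = initial_degree ?J"
    by (rule initial_degree_attained)
  have "indets f \<subseteq> {..N}"
    using f(1) unfolding J fat_ideal_iff coord_ring_carrier by blast
  from generic_collision[OF f(2) this fat_ideal_fat_vanishing[OF f(1)[unfolded J]]]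
  obtain g :: "'k ratfun mpoly" where g: "g \<noteq> 0"
    "keys g \<subseteq> {t. keys t \<subseteq> {..N} \<and> mono_deg t = total_deg f}"
    "\<forall>t. lookup g t \<in> ratfuns (length (?pre @ [2 * m] @ ?post)) N"
    "fat_vanishing N (?pre @ [2 * m] @ ?post) generic_point g" by blast
  have "g \<in> symbolic_power N (pre @ [2] @ post) m"
    using fat_ideal_memI[OF g(2-4)] by (simp add: symbolic_power_def mult.commute)
  then have "initial_degree (symbolic_power N (pre @ [2] @ post) m :: 'k ratfun mpoly set) \<le> total_deg g"
    using g(1) by (rule initial_degree_le)
  also have "total_deg g \<le> total_deg f"
    unfolding total_deg_def[of g] using g(1,2) by (intro Max.boundedI) auto
  finally show ?thesis using f(3) by simp
qed

lemma waldschmidt_collision: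
  assumes "N \<ge> 1"
  shows "waldschmidt TYPE('k::field) N (pre @ [2] @ post)
    \<le> waldschmidt TYPE('k) N (pre @ replicate (2 ^ N) 1 @ post)"
proof -
  have conv: "(\<lambda>m. real (initial_degree (symbolic_power N a m :: 'k ratfun mpoly set)) / real m)
      \<longlonglongrightarrow> waldschmidt TYPE('k) N a" for a
  proof -
    have "convergent (\<lambda>m. real (initial_degree (symbolic_power N a m :: 'k ratfun mpoly set)) / real m)"
      by (rule convergent_subadditive_quotient) (rule initial_degree_symbolic_subadditive[OF assms])
    then show ?thesis by (simp only: waldschmidt_def convergent_LIMSEQ_iff)
  qed
  show ?thesis
    by (rule LIMSEQ_le[OF conv conv], intro exI[of _ 0] allI impI divide_right_mono)
      (simp_all only: of_nat_le_iff of_nat_0_le_iff initial_degree_collision[OF assms])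
qed

text \<open>The last double point is replaced first; its 2^N simple points then join
  \<open>ms\<close>, which is why the induction generalizes over \<open>ms\<close>.\<close>

lemma waldschmidt_replicate:
  assumes "N \<ge> 1"
  shows "waldschmidt TYPE('k::field) N (replicate b 2 @ ms)
    \<le> waldschmidt TYPE('k) N (replicate (b * 2 ^ N) 1 @ ms)"
proof (induction b arbitrary: ms)
  case (Suc b)
  have 1: "replicate (Suc b) (2 :: nat) @ ms = replicate b 2 @ [2] @ ms"
    by (induction b) auto
  have 2: "replicate (Suc b * 2 ^ N) (1 :: nat) @ ms = replicate (b * 2 ^ N) 1 @ replicate (2 ^ N) 1 @ ms"
    by (simp only: mult_Suc add.commute[of "2 ^ N"] replicate_add append_assoc)
  have "waldschmidt TYPE('k) N (replicate b 2 @ [2] @ ms)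
      \<le> waldschmidt TYPE('k) N (replicate b 2 @ replicate (2 ^ N) 1 @ ms)"
    by (rule waldschmidt_collision[OF assms])
  also have "\<dots> \<le> waldschmidt TYPE('k) N (replicate (b * 2 ^ N) 1 @ replicate (2 ^ N) 1 @ ms)"
    by (rule Suc.IH)
  finally show ?case by (simp only: 1 2)
qed simp

theorem proposition3p6:
  fixes N :: nat and ms :: "nat list"
  assumes "N \<ge> 4" and "\<forall>m\<in>set ms. m > 0"
  shows "waldschmidt TYPE('k::alg_closed_field) N (replicate (2 ^ N) 1 @ ms)
           \<ge> waldschmidt TYPE('k) N (2 # ms)
       \<and> (\<forall>b::nat. b > 0 \<longrightarrow>
            waldschmidt TYPE('k) N (replicate (b * 2 ^ N) 1 @ ms)
              \<ge> waldschmidt TYPE('k) N (replicate b 2 @ ms))"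
proof -
  have "N \<ge> 1" using assms(1) by simp
  then show ?thesis
    using waldschmidt_collision[of N "[]" ms] waldschmidt_replicate[of N _ ms] by auto
qed

end
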